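(* Let $\{b_k\}_{k=1}^\infty$, $\{p_k\}_{k=1}^\infty$, $\{t_k\}_{k=1}^\infty$ be integer sequences with $p_k\ge 2$, $|b_k|\ge 2$ and $|t_k|\ge 1$ for all $k$, such that $\{p_kt_k\}_{k=1}^\infty$ is bounded, and let $D_k=\{0,1,\dots,p_k-1\}t_k$. Let $$\mu=\delta_{b_1^{-1}D_1}*\delta_{b_1^{-1}b_2^{-1}D_2}*\delta_{b_1^{-1}b_2^{-1}b_3^{-1}D_3}*\cdots,$$ and for $k\ge1$ let $$\nu_{>k}=\delta_{b_{k+1}^{-1}D_{k+1}}*\delta_{b_{k+1}^{-1}b_{k+2}^{-1}D_{k+2}}*\delta_{b_{k+1}^{-1}b_{k+2}^{-1}b_{k+3}^{-1}D_{k+3}}*\cdots.$$ Suppose that $p_k\nmid t_{k+1}$ for all $k\ge1$ and that $\mu$ is a spectral measure. Then for all $k\ge 1$, $p_{k+1}\mid (b_{k+1}t_k)$ and $\nu_{>k}$ is a spectral measure.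
   Context: For a finite nonempty set $E\subset\mathbb R$, $\delta_E=\frac1{\#E}\sum_{e\in E}\delta_e$, where $\delta_e$ is the Dirac point mass at $e$; $*$ denotes convolution. For an integer $t$, $\{0,1,\dots,p-1\}t=\{0,t,\dots,(p-1)t\}$. The infinite convolutions are weak limits of their finite partial convolutions; here they exist and are compactly supported Borel probability measures. A compactly supported Borel probability measure $\mu$ on $\mathbb R$ is a spectral measure if there is a countable discrete set $\Lambda\subset\mathbb R$ (a spectrum of $\mu$) such that $\{e^{2\pi i\lambda x}:\lambda\in\Lambda\}$ is an orthogonal basis of $L^2(\mu)$. *)

theory Defs
  imports "HOL-Probability.Probability"
begin

text \<open>The measure \<open>\<delta>\<^sub>E\<close>, i.e. the average of the Dirac masses at the points of a finite
  nonempty set \<open>E\<close>, as a Borel measure on the line.\<close>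

definition dirac_average :: "real set \<Rightarrow> real measure" where
  "dirac_average E = distr (measure_pmf (pmf_of_set E)) borel (\<lambda>x. x)"

lemma measure_dirac_average:
  assumes "finite E" "E \<noteq> {}" "A \<in> sets borel"
  shows "measure (dirac_average E) A = (\<Sum>e\<in>E. measure (return borel e) A) / card E"
proof -
  have "measure (dirac_average E) A = measure (measure_pmf (pmf_of_set E)) A"
    using assms by (simp add: dirac_average_def measure_distr)
  also have "\<dots> = card (E \<inter> A) / card E"
    using assms by (simp add: measure_pmf_of_set)
  also have "real (card (E \<inter> A)) = (\<Sum>e\<in>E. measure (return borel e) A)"
    using assms by (simp add: measure_return indicator_def sum.If_cases Int_def)
  finally show ?thesis .
qed

text \<open>\<open>partial_convolution M n\<close> is \<open>M 1 \<star> \<dots> \<star> M n\<close>; the value \<open>M 0\<close> is not used, and the empty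
  convolution is the Dirac mass at 0.\<close>

primrec partial_convolution :: "(nat \<Rightarrow> real measure) \<Rightarrow> nat \<Rightarrow> real measure" where
  "partial_convolution M 0 = return borel 0"
| "partial_convolution M (Suc n) = (partial_convolution M n \<star> M (Suc n))"

text \<open>The infinite convolution is the weak limit of the partial ones. It is specified by a definite
  description, so it is meaningful only if the limit exists; the limit is then unique.\<close>

definition infinite_convolution :: "(nat \<Rightarrow> real measure) \<Rightarrow> real measure" where
  "infinite_convolution M =
     (THE \<mu>. real_distribution \<mu> \<and> weak_conv_m (partial_convolution M) \<mu>)"

lemma infinite_convolution_eqI:
  assumes M: "\<And>n. real_distribution (M n)"
    and \<mu>: "real_distribution \<mu>" "weak_conv_m (partial_convolution M) \<mu>"
  shows "infinite_convolution M = \<mu>"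
proof -
  have rd: "real_distribution (partial_convolution M n)" for n
  proof (induction n)
    case 0
    show ?case
      by (simp add: real_distribution_def real_distribution_axioms_def prob_space_return)
  next
    case (Suc n)
    interpret A: real_distribution "partial_convolution M n" by (rule Suc)
    interpret B: real_distribution "M (Suc n)" by (rule M)
    interpret AB: pair_prob_space "partial_convolution M n" "M (Suc n)" ..
    have "prob_space (partial_convolution M n \<star> M (Suc n))"
      unfolding convolution_def by (rule AB.P.prob_space_distr) simp
    then show ?case
      by (simp add: real_distribution_def real_distribution_axioms_def)
  qed
  show ?thesis
    unfolding infinite_convolution_def
  proof (rule the_equality)
    fix \<nu> assume \<nu>: "real_distribution \<nu> \<and> weak_conv_m (partial_convolution M) \<nu>"
    have "char \<nu> t = char \<mu> t" for t
    proof (rule LIMSEQ_unique)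
      show "(\<lambda>n. char (partial_convolution M n) t) \<longlonglongrightarrow> char \<nu> t"
        using rd \<nu> by (intro levy_continuity1) auto
      show "(\<lambda>n. char (partial_convolution M n) t) \<longlonglongrightarrow> char \<mu> t"
        using rd \<mu> by (intro levy_continuity1)
    qed
    then have "char \<nu> = char \<mu>" ..
    then show "\<nu> = \<mu>"
      using \<nu> \<mu> by (intro Levy_uniqueness) auto
  qed (use \<mu> in auto)
qed

definition square_integrable :: "'a measure \<Rightarrow> ('a \<Rightarrow> complex) \<Rightarrow> bool" where
  "square_integrable M f \<longleftrightarrow> f \<in> borel_measurable M \<and> integrable M (\<lambda>x. (norm (f x))\<^sup>2)"

text \<open>Elements of \<open>L\<^sup>2(M)\<close> are represented by square-integrable functions: a family of nonzero,
  pairwise orthogonal elements is an orthogonal basis if its linear span is dense.\<close>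

definition orthogonal_L2_basis ::
  "'a measure \<Rightarrow> 'i set \<Rightarrow> ('i \<Rightarrow> 'a \<Rightarrow> complex) \<Rightarrow> bool" where
  "orthogonal_L2_basis M I e \<longleftrightarrow>
     (\<forall>i\<in>I. square_integrable M (e i) \<and> (LINT x|M. (norm (e i x))\<^sup>2) \<noteq> 0) \<and>
     (\<forall>i\<in>I. \<forall>j\<in>I. i \<noteq> j \<longrightarrow> (LINT x|M. e i x * cnj (e j x)) = 0) \<and>
     (\<forall>f. square_integrable M f \<longrightarrow> (\<forall>\<epsilon>>0. \<exists>F c. finite F \<and> F \<subseteq> I \<and>
        (LINT x|M. (norm (f x - (\<Sum>i\<in>F. c i * e i x)))\<^sup>2) < \<epsilon>))"

definition is_spectrum :: "real measure \<Rightarrow> real set \<Rightarrow> bool" where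
  "is_spectrum M \<Lambda> \<longleftrightarrow> countable \<Lambda> \<and> topological_space_class.discrete \<Lambda> \<and>
     orthogonal_L2_basis M \<Lambda> (\<lambda>l x. exp (2 * of_real pi * \<i> * of_real l * of_real x))"

definition compactly_supported :: "real measure \<Rightarrow> bool" where
  "compactly_supported M \<longleftrightarrow> (\<exists>K. compact K \<and> emeasure M (- K) = 0)"

definition spectral_measure :: "real measure \<Rightarrow> bool" where
  "spectral_measure M \<longleftrightarrow>
     real_distribution M \<and> compactly_supported M \<and> (\<exists>\<Lambda>. is_spectrum M \<Lambda>)"

definition digit_set :: "(nat \<Rightarrow> int) \<Rightarrow> (nat \<Rightarrow> int) \<Rightarrow> nat \<Rightarrow> int set" where
  "digit_set p t k = (\<lambda>i. i * t k) ` {0..p k - 1}"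

text \<open>All sequences are indexed from 1; their values at 0 are not used.\<close>

definition moran_measure ::
  "(nat \<Rightarrow> int) \<Rightarrow> (nat \<Rightarrow> int) \<Rightarrow> (nat \<Rightarrow> int) \<Rightarrow> real measure" where
  "moran_measure b p t = infinite_convolution (\<lambda>n.
     dirac_average ((\<lambda>d. of_int d / (\<Prod>j=1..n. of_int (b j))) ` digit_set p t n))"

definition moran_tail ::
  "(nat \<Rightarrow> int) \<Rightarrow> (nat \<Rightarrow> int) \<Rightarrow> (nat \<Rightarrow> int) \<Rightarrow> nat \<Rightarrow> real measure" where
  "moran_tail b p t k = infinite_convolution (\<lambda>n.
     dirac_average ((\<lambda>d. of_int d / (\<Prod>j=k+1..k+n. of_int (b j))) ` digit_set p t (k + n)))"

end

theory Submission
  imports Defs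
begin

text \<open>Write \<open>\<mu> = \<delta>\<^sub>D \<star> \<nu>\<close> with \<open>D = {0, t, \<dots>, (P - 1) t}\<close>, and let \<open>G = \<int> / (P t)\<close> and \<open>H = \<int> / t\<close>. The Fourier
  transform of \<open>\<delta>\<^sub>D\<close> is 1 on \<open>H\<close> and vanishes exactly on \<open>G - H\<close>. Hence, if \<open>\<Lambda>\<close> is a spectrum of \<open>\<mu>\<close> and
  one keeps, in every coset of \<open>G\<close>, only the points of \<open>\<Lambda>\<close> in one residue class modulo \<open>H\<close>, the remaining
  characters are orthogonal in \<open>L\<^sup>2(\<nu>)\<close>. Comparing the Parseval identity for \<open>\<mu>\<close> with the Bessel
  inequality for the best such selection shows that every selection is a spectrum of \<open>\<nu>\<close>; in
  particular \<open>\<nu>\<close> is spectral, and \<open>\<Lambda>\<close> meets every residue class of each coset that it meets. For the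
  divisibility, a selection for step \<open>k\<close> is chosen adversarially against this last property for
  step \<open>k + 1\<close>.\<close>

section \<open>Closed linear spans in \<open>L\<^sup>2\<close>\<close>

text \<open>The comparison of Parseval with Bessel is made at a frequency \<open>y\<close> outside
  \<open>\<Lambda> + G\<close>. There the transform of \<delta>_D vanishes at no
  \<open>y - l\<close>, so every residue enters the average with positive weight, and equality
  forces it to be maximal. A \<open>y\<close> in \<open>l + G\<close> would see a single residue of
  that coset and say nothing about the others. Since \<Lambda> and \<open>G\<close> are countable,
  only countably many \<open>y\<close> are lost, and they are recovered because characters depend
  continuously in L2 on their frequency. Completeness in L2(\<nu>) is inherited rather than proved
  anew: 0 lies in \<open>D\<close>, so \<nu> is at most \<open>P\<close> times \<mu>, and
  approximations in L2(\<mu>) stay approximations in L2(\<nu>). The adversary for the divisibility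
  has to avoid a coset \<open>R\<close> of
  \<open>b\<^sub>k\<^sub>+\<^sub>1 \<int> / t\<^sub>k\<^sub>+\<^sub>1\<close>. With
  \<open>s = 1 / (p\<^sub>k t\<^sub>k)\<close> and \<open>H = \<int> / t\<^sub>k\<close>, the set
  \<open>R\<close> can meet both \<open>x + H\<close> and \<open>x + s + H\<close> only if
  \<open>p\<^sub>k\<close> divides \<open>t\<^sub>k\<^sub>+\<^sub>1\<close>. So the hypothesis
  leaves, in every coset of \<open>G\<close>, a residue class that is free of
  \<open>R\<close>.\<close>

lemma norm_diff_power2_le:
  fixes a b c :: "'a::real_normed_vector"
  shows "(norm (a - c))\<^sup>2 \<le> 2 * (norm (a - b))\<^sup>2 + 2 * (norm (b - c))\<^sup>2"
proof -
  have "norm (a - c) \<le> norm (a - b) + norm (b - c)"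
    using norm_triangle_ineq[of "a - b" "b - c"] by simp
  then have "(norm (a - c))\<^sup>2 \<le> (norm (a - b) + norm (b - c))\<^sup>2"
    by (intro power_mono) auto
  also have "\<dots> \<le> 2 * (norm (a - b))\<^sup>2 + 2 * (norm (b - c))\<^sup>2"
    using sum_squares_bound[of "norm (a - b)" "norm (b - c)"] by (simp add: power2_sum)
  finally show ?thesis .
qed

lemma square_integrable_diff:
  assumes "square_integrable M f" "square_integrable M g"
  shows "square_integrable M (\<lambda>x. f x - g x)"
  unfolding square_integrable_def
proof
  show [measurable]: "(\<lambda>x. f x - g x) \<in> borel_measurable M"
    using assms by (auto simp: square_integrable_def)
  show "integrable M (\<lambda>x. (norm (f x - g x))\<^sup>2)"
  proof (rule Bochner_Integration.integrable_bound)
    show "integrable M (\<lambda>x. 2 * (norm (f x))\<^sup>2 + 2 * (norm (g x))\<^sup>2)"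
      using assms by (auto simp: square_integrable_def)
    show "AE x in M. norm ((norm (f x - g x))\<^sup>2) \<le> norm (2 * (norm (f x))\<^sup>2 + 2 * (norm (g x))\<^sup>2)"
      using norm_diff_power2_le[of "f _" "g _" 0] by auto
  qed simp
qed

lemma square_integrable_cmult:
  assumes "square_integrable M f"
  shows "square_integrable M (\<lambda>x. c * f x)"
  using assms by (auto simp: square_integrable_def norm_mult power_mult_distrib)

lemma square_integrable_add:
  assumes "square_integrable M f" "square_integrable M g"
  shows "square_integrable M (\<lambda>x. f x + g x)"
  using square_integrable_diff[OF assms(1) square_integrable_cmult[OF assms(2), of "-1"]] by simp

lemma square_integrable_sum:
  assumes "\<And>i. i \<in> F \<Longrightarrow> square_integrable M (f i)"
  shows "square_integrable M (\<lambda>x. \<Sum>i\<in>F. f i x)"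
  using assms
proof (induction F rule: infinite_finite_induct)
  case (insert i F)
  then show ?case by (simp add: square_integrable_add)
qed (simp_all add: square_integrable_def)

lemma square_integrable_bounded:
  assumes "finite_measure M" "f \<in> borel_measurable M" "\<And>x. norm (f x) \<le> B"
  shows "square_integrable M f"
  unfolding square_integrable_def
proof
  interpret finite_measure M by fact
  show "integrable M (\<lambda>x. (norm (f x))\<^sup>2)"
  proof (rule integrable_const_bound)
    show "AE x in M. norm ((norm (f x))\<^sup>2) \<le> B\<^sup>2"
      using assms(3) by (auto intro!: power_mono)
  qed (use assms(2) in measurable)
qed fact

lemma L2_dist_triangle:
  assumes "square_integrable M f" "square_integrable M g" "square_integrable M h"
  shows "(LINT x|M. (norm (f x - h x))\<^sup>2)
    \<le> 2 * (LINT x|M. (norm (f x - g x))\<^sup>2) + 2 * (LINT x|M. (norm (g x - h x))\<^sup>2)"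
proof -
  have int: "integrable M (\<lambda>x. (norm (u x - v x))\<^sup>2)"
    if "square_integrable M u" "square_integrable M v" for u v
    using square_integrable_diff[OF that] by (simp add: square_integrable_def)
  have "(LINT x|M. (norm (f x - h x))\<^sup>2)
      \<le> (LINT x|M. 2 * (norm (f x - g x))\<^sup>2 + 2 * (norm (g x - h x))\<^sup>2)"
    using int assms by (intro integral_mono norm_diff_power2_le) auto
  also have "\<dots> = 2 * (LINT x|M. (norm (f x - g x))\<^sup>2) + 2 * (LINT x|M. (norm (g x - h x))\<^sup>2)"
    using int assms by simp
  finally show ?thesis .
qed

text \<open>The density clause of \<open>orthogonal_L2_basis\<close>, isolated for a single
  \<open>f\<close>: membership in the closed linear span, so that completeness can be established
  first for characters, then for bounded functions, then for all \<open>f\<close>.\<close>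

definition L2_approximable ::
  "'a measure \<Rightarrow> 'i set \<Rightarrow> ('i \<Rightarrow> 'a \<Rightarrow> complex) \<Rightarrow> ('a \<Rightarrow> complex) \<Rightarrow> bool" where
  "L2_approximable M I e f \<longleftrightarrow> (\<forall>\<epsilon>>0. \<exists>F c. finite F \<and> F \<subseteq> I \<and>
     (LINT x|M. (norm (f x - (\<Sum>i\<in>F. c i * e i x)))\<^sup>2) < \<epsilon>)"

lemma L2_approximableD:
  assumes "L2_approximable M I e f" "\<epsilon> > 0"
  obtains F c where "finite F" "F \<subseteq> I"
    "(LINT x|M. (norm (f x - (\<Sum>i\<in>F. c i * e i x)))\<^sup>2) < \<epsilon>"
  using assms unfolding L2_approximable_def by blast

lemma L2_approximable_closed:
  assumes e: "\<And>i. i \<in> I \<Longrightarrow> square_integrable M (e i)" and f: "square_integrable M f"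
    and approx: "\<And>\<epsilon>. \<epsilon> > 0 \<Longrightarrow> \<exists>g. square_integrable M g \<and> L2_approximable M I e g \<and>
      (LINT x|M. (norm (f x - g x))\<^sup>2) < \<epsilon>"
  shows "L2_approximable M I e f"
  unfolding L2_approximable_def
proof (intro allI impI)
  fix \<epsilon> :: real assume "\<epsilon> > 0"
  then obtain g where g: "square_integrable M g" "L2_approximable M I e g"
      "(LINT x|M. (norm (f x - g x))\<^sup>2) < \<epsilon> / 4"
    using approx[of "\<epsilon> / 4"] by auto
  obtain F c where F: "finite F" "F \<subseteq> I"
      "(LINT x|M. (norm (g x - (\<Sum>i\<in>F. c i * e i x)))\<^sup>2) < \<epsilon> / 4"
    using L2_approximableD[OF g(2), of "\<epsilon> / 4"] \<open>\<epsilon> > 0\<close> by auto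
  have "square_integrable M (\<lambda>x. \<Sum>i\<in>F. c i * e i x)"
    using F e by (intro square_integrable_sum square_integrable_cmult) auto
  from L2_dist_triangle[OF f g(1) this] F g(3)
  show "\<exists>F c. finite F \<and> F \<subseteq> I \<and> (LINT x|M. (norm (f x - (\<Sum>i\<in>F. c i * e i x)))\<^sup>2) < \<epsilon>"
    by (intro exI[of _ F] exI[of _ c]) auto
qed

lemma L2_approximable_0: "L2_approximable M I e (\<lambda>x. 0)"
  unfolding L2_approximable_def by (intro allI impI exI[of _ "{}"]) auto

lemma L2_approximable_cmult:
  assumes "L2_approximable M I e f"
  shows "L2_approximable M I e (\<lambda>x. a * f x)"
  unfolding L2_approximable_def
proof (intro allI impI)
  fix \<epsilon> :: real assume \<epsilon>: "\<epsilon> > 0"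
  show "\<exists>F c. finite F \<and> F \<subseteq> I \<and> (LINT x|M. (norm (a * f x - (\<Sum>i\<in>F. c i * e i x)))\<^sup>2) < \<epsilon>"
  proof (cases "a = 0")
    case False
    have "\<epsilon> / (norm a)\<^sup>2 > 0" using \<epsilon> False by simp
    then obtain F c where F: "finite F" "F \<subseteq> I"
        "(LINT x|M. (norm (f x - (\<Sum>i\<in>F. c i * e i x)))\<^sup>2) < \<epsilon> / (norm a)\<^sup>2"
      using L2_approximableD[OF assms] by blast
    have "(norm (a * f x - (\<Sum>i\<in>F. (a * c i) * e i x)))\<^sup>2
        = (norm a)\<^sup>2 * (norm (f x - (\<Sum>i\<in>F. c i * e i x)))\<^sup>2" for x
      by (simp flip: norm_mult power_mult_distrib
          add: right_diff_distrib sum_distrib_left mult.assoc)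
    then have "(LINT x|M. (norm (a * f x - (\<Sum>i\<in>F. (a * c i) * e i x)))\<^sup>2)
        = (norm a)\<^sup>2 * (LINT x|M. (norm (f x - (\<Sum>i\<in>F. c i * e i x)))\<^sup>2)"
      by simp
    also have "\<dots> < \<epsilon>"
      using F(3) False by (simp add: field_simps)
    finally show ?thesis
      using F(1,2) by (intro exI[of _ F] exI[of _ "\<lambda>i. a * c i"]) auto
  qed (use \<epsilon> in \<open>auto intro!: exI[of _ "{}"]\<close>)
qed

lemma L2_approximable_add:
  assumes e: "\<And>i. i \<in> I \<Longrightarrow> square_integrable M (e i)"
    and f: "square_integrable M f" "L2_approximable M I e f"
    and g: "square_integrable M g" "L2_approximable M I e g"
  shows "L2_approximable M I e (\<lambda>x. f x + g x)"
  unfolding L2_approximable_def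
proof (intro allI impI)
  fix \<epsilon> :: real assume \<epsilon>: "\<epsilon> > 0"
  obtain F c where F: "finite F" "F \<subseteq> I"
      "(LINT x|M. (norm (f x - (\<Sum>i\<in>F. c i * e i x)))\<^sup>2) < \<epsilon> / 4"
    using L2_approximableD[OF f(2), of "\<epsilon> / 4"] \<epsilon> by auto
  obtain G d where G: "finite G" "G \<subseteq> I"
      "(LINT x|M. (norm (g x - (\<Sum>i\<in>G. d i * e i x)))\<^sup>2) < \<epsilon> / 4"
    using L2_approximableD[OF g(2), of "\<epsilon> / 4"] \<epsilon> by auto
  define s where "s x = (\<Sum>i\<in>F. c i * e i x)" for x
  define r where "r x = (\<Sum>i\<in>G. d i * e i x)" for x
  have s: "square_integrable M s" and r: "square_integrable M r"
    unfolding s_def r_def using F G e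
    by (auto intro!: square_integrable_sum square_integrable_cmult)
  \<comment> \<open>Both coefficient families are extended by zero to \<open>F \<union> G\<close>;
    on the overlap they add.\<close>
  define b where "b i = (if i \<in> F then c i else 0) + (if i \<in> G then d i else 0)" for i
  have b: "(\<Sum>i\<in>F \<union> G. b i * e i x) = s x + r x" for x
  proof -
    have "(\<Sum>i\<in>F \<union> G. b i * e i x) = (\<Sum>i\<in>F \<union> G. (if i \<in> F then c i * e i x else 0))
        + (\<Sum>i\<in>F \<union> G. (if i \<in> G then d i * e i x else 0))"
      unfolding b_def sum.distrib[symmetric] by (intro sum.cong) (auto simp: algebra_simps)
    also have "\<dots> = s x + r x"
      using F(1) G(1) by (auto simp: s_def r_def sum.If_cases Int_absorb1 intro!: arg_cong2[where f="(+)"] sum.cong)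
    finally show ?thesis .
  qed
  have "(LINT x|M. (norm ((f x + g x) - (s x + r x)))\<^sup>2)
      \<le> 2 * (LINT x|M. (norm ((f x + g x) - (s x + g x)))\<^sup>2)
        + 2 * (LINT x|M. (norm ((s x + g x) - (s x + r x)))\<^sup>2)"
    by (intro L2_dist_triangle square_integrable_add f g s r)
  also have "\<dots> < \<epsilon>"
    using F(3) G(3) by (simp flip: s_def r_def)
  finally show "\<exists>F c. finite F \<and> F \<subseteq> I \<and>
      (LINT x|M. (norm (f x + g x - (\<Sum>i\<in>F. c i * e i x)))\<^sup>2) < \<epsilon>"
    using F G b by (intro exI[of _ "F \<union> G"] exI[of _ b]) auto
qed

lemma L2_approximable_sum:
  assumes e: "\<And>i. i \<in> I \<Longrightarrow> square_integrable M (e i)"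
    and f: "\<And>j. j \<in> J \<Longrightarrow> square_integrable M (f j)" "\<And>j. j \<in> J \<Longrightarrow> L2_approximable M I e (f j)"
  shows "L2_approximable M I e (\<lambda>x. \<Sum>j\<in>J. f j x)"
  using f
proof (induction J rule: infinite_finite_induct)
  case (insert j J)
  then show ?case
    by (simp add: L2_approximable_add[OF e] square_integrable_sum)
qed (simp_all add: L2_approximable_0)

text \<open>A function in L2(\<nu>) may fail to lie in L2(D \<star> \<nu>), whereas a bounded one
  lies in both; truncation reduces completeness in L2(\<nu>) to bounded functions.\<close>

lemma square_integrable_truncate:
  assumes "square_integrable M f" "\<epsilon> > 0"
  obtains B :: real where "(LINT x|M. (norm (f x - (if norm (f x) \<le> B then f x else 0)))\<^sup>2) < \<epsilon>"
proof -
  have [measurable]: "f \<in> borel_measurable M" and int: "integrable M (\<lambda>x. (norm (f x))\<^sup>2)"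
    using assms by (auto simp: square_integrable_def)
  let ?g = "\<lambda>n x. (norm (f x - (if norm (f x) \<le> real n then f x else 0)))\<^sup>2"
  have "(\<lambda>n. LINT x|M. ?g n x) \<longlonglongrightarrow> (LINT x|M. 0)"
  proof (rule integral_dominated_convergence[OF _ _ int])
    show "AE x in M. (\<lambda>n. ?g n x) \<longlonglongrightarrow> 0"
    proof (intro AE_I2 tendsto_eventually)
      fix x
      show "\<forall>\<^sub>F n in sequentially. ?g n x = 0"
        using eventually_ge_at_top[of "nat \<lceil>norm (f x)\<rceil>"]
      proof eventually_elim
        case (elim n)
        then have "norm (f x) \<le> real n" by linarith
        then show ?case by simp
      qed
    qed
  qed auto
  then have "\<forall>\<^sub>F n in sequentially. (LINT x|M. ?g n x) < \<epsilon>"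
    using assms(2) by (intro order_tendstoD) auto
  then show thesis
    using that by (auto simp: eventually_sequentially)
qed

section \<open>Characters and the Bessel inequality\<close>

definition character :: "real \<Rightarrow> real \<Rightarrow> complex" where
  "character l x = exp (2 * of_real pi * \<i> * of_real l * of_real x)"

lemma character_eq_cis: "character l x = cis (2 * pi * l * x)"
  by (simp add: character_def cis_conv_exp mult_ac)

lemma norm_character [simp]: "norm (character l x) = 1"
  by (simp add: character_eq_cis)

lemma character_measurable [measurable]: "character l \<in> borel_measurable borel"
  unfolding character_def by measurable

lemma character_mult_cnj: "character k x * cnj (character l x) = character (k - l) x"
  by (simp add: character_eq_cis cis_cnj cis_mult algebra_simps)

lemma character_add: "character (k + l) x = character k x * character l x"
  by (simp add: character_eq_cis cis_mult algebra_simps)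

lemma character_add_right: "character l (x + y) = character l x * character l y"
  by (simp add: character_eq_cis cis_mult algebra_simps)

lemma cnj_character: "cnj (character l x) = character (- l) x"
  by (simp add: character_eq_cis cis_cnj)

lemma character_0 [simp]: "character 0 x = 1"
  by (simp add: character_eq_cis)

lemma character_scale: "character l (c * x) = character (c * l) x"
  by (simp add: character_eq_cis mult_ac)

lemma character_0_right [simp]: "character l 0 = 1"
  by (simp add: character_eq_cis)

definition fourier :: "real measure \<Rightarrow> real \<Rightarrow> complex" where
  "fourier M l = (LINT x|M. character l x)"

lemma fourier_eq_char: "fourier M l = char M (2 * pi * l)"
  by (simp add: fourier_def char_def character_def mult_ac)

lemma char_eq_fourier: "char M s = fourier M (s / (2 * pi))"
  by (simp add: fourier_eq_char)

lemma fourier_minus: "fourier M (- l) = cnj (fourier M l)"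
  using Bochner_Integration.integral_cnj[of M "character l"] by (simp add: fourier_def cnj_character)

text \<open>The inner product of two characters is the Fourier transform at the difference of their
  frequencies, so orthogonality becomes a statement about zeros of \<open>fourier M\<close>.\<close>

definition orthogonal_characters :: "real measure \<Rightarrow> real set \<Rightarrow> bool" where
  "orthogonal_characters M \<Lambda> \<longleftrightarrow> (\<forall>i\<in>\<Lambda>. \<forall>j\<in>\<Lambda>. i \<noteq> j \<longrightarrow> fourier M (i - j) = 0)"

context real_distribution
begin

lemma character_measurable' [measurable]: "character l \<in> borel_measurable M"
  by simp

lemma character_integrable [simp]: "integrable M (character l)"
  by (rule integrable_const_bound[of _ 1]) auto

lemma character_square_integrable [simp]: "square_integrable M (character l)"
  by (rule square_integrable_bounded[of _ _ 1]) (auto simp: finite_measure_axioms)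

lemma character_sum_square_integrable: "square_integrable M (\<lambda>x. \<Sum>i\<in>F. c i * character i x)"
  by (intro square_integrable_sum square_integrable_cmult character_square_integrable)

lemma fourier_0 [simp]: "fourier M 0 = 1"
  using prob_space by (simp add: fourier_def)

text \<open>Completing the square in the coefficients \<open>c\<close>. The last sum vanishes
  exactly at the Fourier coefficients, so this one identity yields the Bessel inequality, the
  Parseval identity and its converse.\<close>

lemma character_dist_sum:
  assumes "finite F" and orth: "\<And>i j. i \<in> F \<Longrightarrow> j \<in> F \<Longrightarrow> i \<noteq> j \<Longrightarrow> fourier M (i - j) = 0"
  shows "(LINT x|M. (norm (character y x - (\<Sum>i\<in>F. c i * character i x)))\<^sup>2)
    = 1 - (\<Sum>i\<in>F. (norm (fourier M (y - i)))\<^sup>2) + (\<Sum>i\<in>F. (norm (c i - fourier M (y - i)))\<^sup>2)"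
    (is "?L = ?R")
proof -
  define h where "h = fourier M"
  define A where "A = (\<lambda>x. (\<Sum>j\<in>F. cnj (c j) * character (y - j) x))"
  define B where "B = (\<lambda>x. (\<Sum>i\<in>F. c i * character (i - y) x))"
  define C where "C = (\<lambda>x. (\<Sum>i\<in>F. \<Sum>j\<in>F. c i * cnj (c j) * character (i - j) x))"
  have A: "has_bochner_integral M A (\<Sum>j\<in>F. cnj (c j) * h (y - j))"
    and B: "has_bochner_integral M B (\<Sum>i\<in>F. c i * h (i - y))"
    and C: "has_bochner_integral M C (\<Sum>i\<in>F. \<Sum>j\<in>F. c i * cnj (c j) * h (i - j))"
    unfolding A_def B_def C_def h_def fourier_def
    by (rule has_bochner_integral_sum has_bochner_integral_mult_right
        has_bochner_integral_integrable character_integrable)+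
  have expand: "complex_of_real ((norm (character y x - (\<Sum>i\<in>F. c i * character i x)))\<^sup>2)
      = 1 - A x - B x + C x" for x
  proof -
    let ?u = "character y x" and ?s = "\<Sum>i\<in>F. c i * character i x"
    have s': "cnj ?s = (\<Sum>j\<in>F. cnj (c j) * cnj (character j x))"
      by simp
    have "?u * cnj ?s = (\<Sum>j\<in>F. cnj (c j) * (?u * cnj (character j x)))"
      unfolding s' sum_distrib_left by (intro sum.cong refl) (rule mult.left_commute)
    moreover have "?s * cnj ?u = (\<Sum>i\<in>F. c i * (character i x * cnj ?u))"
      unfolding sum_distrib_right by (intro sum.cong refl) (rule mult.assoc)
    moreover have "?s * cnj ?s
        = (\<Sum>i\<in>F. \<Sum>j\<in>F. c i * cnj (c j) * (character i x * cnj (character j x)))"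
      unfolding s' sum_product by (intro sum.cong refl) (simp only: mult_ac)
    ultimately have "?u * cnj ?s = A x" "?s * cnj ?u = B x" "?s * cnj ?s = C x"
      by (simp_all only: A_def B_def C_def character_mult_cnj)
    moreover have "complex_of_real ((norm (?u - ?s))\<^sup>2)
        = ?u * cnj ?u - ?u * cnj ?s - ?s * cnj ?u + ?s * cnj ?s"
      unfolding complex_norm_square complex_cnj_diff by (simp only: algebra_simps)
    ultimately show ?thesis
      by (simp only: character_mult_cnj diff_self character_0)
  qed
  have "complex_of_real ?L =
      (LINT x|M. complex_of_real ((norm (character y x - (\<Sum>i\<in>F. c i * character i x)))\<^sup>2))"
    by (rule integral_complex_of_real[symmetric])
  also have "\<dots> = (LINT x|M. 1 - A x - B x + C x)"
    by (simp only: expand)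
  also have "\<dots> = 1 - (\<Sum>j\<in>F. cnj (c j) * h (y - j)) - (\<Sum>i\<in>F. c i * h (i - y))
        + (\<Sum>i\<in>F. \<Sum>j\<in>F. c i * cnj (c j) * h (i - j))"
  proof (intro has_bochner_integral_integral_eq has_bochner_integral_add
      has_bochner_integral_diff A B C)
    show "has_bochner_integral M (\<lambda>x. 1) (1 :: complex)"
      using prob_space by (simp add: has_bochner_integral_iff)
  qed
  also have "(\<Sum>i\<in>F. \<Sum>j\<in>F. c i * cnj (c j) * h (i - j)) = (\<Sum>i\<in>F. c i * cnj (c i))"
  proof (intro sum.cong refl)
    fix i assume "i \<in> F"
    have "(\<Sum>j\<in>F. c i * cnj (c j) * h (i - j)) = (\<Sum>j\<in>F. if j = i then c i * cnj (c i) else 0)"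
      using orth \<open>i \<in> F\<close> by (intro sum.cong) (auto simp: h_def)
    then show "(\<Sum>j\<in>F. c i * cnj (c j) * h (i - j)) = c i * cnj (c i)"
      using \<open>i \<in> F\<close> \<open>finite F\<close> by simp
  qed
  also have "(\<Sum>i\<in>F. c i * h (i - y)) = (\<Sum>i\<in>F. c i * cnj (h (y - i)))"
    unfolding h_def by (simp flip: fourier_minus)
  also have "1 - (\<Sum>j\<in>F. cnj (c j) * h (y - j)) - (\<Sum>i\<in>F. c i * cnj (h (y - i)))
        + (\<Sum>i\<in>F. c i * cnj (c i))
      = 1 - (\<Sum>i\<in>F. h (y - i) * cnj (h (y - i)))
        + (\<Sum>i\<in>F. (c i - h (y - i)) * cnj (c i - h (y - i)))"
    by (simp only: complex_cnj_diff left_diff_distrib right_diff_distrib sum_subtractf)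
      (simp add: mult.commute)
  also have "\<dots> = complex_of_real ?R"
    by (simp only: h_def of_real_add of_real_diff of_real_1 of_real_sum complex_norm_square)
  finally show ?thesis
    by (simp only: of_real_eq_iff)
qed

lemma bessel_finite:
  assumes "orthogonal_characters M \<Lambda>" "finite F" "F \<subseteq> \<Lambda>"
  shows "(\<Sum>i\<in>F. (norm (fourier M (y - i)))\<^sup>2) \<le> 1"
proof -
  have "0 \<le> (LINT x|M. (norm (character y x - (\<Sum>i\<in>F. fourier M (y - i) * character i x)))\<^sup>2)"
    by simp
  also have "\<dots> = 1 - (\<Sum>i\<in>F. (norm (fourier M (y - i)))\<^sup>2)"
    using assms by (subst character_dist_sum) (auto simp: orthogonal_characters_def)
  finally show ?thesis by simp
qed

lemma bessel_summable:
  assumes "orthogonal_characters M \<Lambda>"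
  shows "(\<lambda>i. (norm (fourier M (y - i)))\<^sup>2) summable_on \<Lambda>"
proof (rule nonneg_bdd_above_summable_on)
  show "bdd_above (sum (\<lambda>i. (norm (fourier M (y - i)))\<^sup>2) ` {F. F \<subseteq> \<Lambda> \<and> finite F})"
    by (rule bdd_aboveI2[of _ _ 1]) (simp add: bessel_finite[OF assms])
qed simp

lemma bessel:
  assumes "orthogonal_characters M \<Lambda>"
  shows "(\<Sum>\<^sub>\<infinity>i\<in>\<Lambda>. (norm (fourier M (y - i)))\<^sup>2) \<le> 1"
  by (rule infsum_le_finite_sums[OF bessel_summable[OF assms]]) (rule bessel_finite[OF assms])

lemma parseval_of_approximable:
  assumes orth: "orthogonal_characters M \<Lambda>" and approx: "L2_approximable M \<Lambda> character (character y)"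
  shows "((\<lambda>i. (norm (fourier M (y - i)))\<^sup>2) has_sum 1) \<Lambda>"
proof -
  define S where "S = (\<Sum>\<^sub>\<infinity>i\<in>\<Lambda>. (norm (fourier M (y - i)))\<^sup>2)"
  have S: "((\<lambda>i. (norm (fourier M (y - i)))\<^sup>2) has_sum S) \<Lambda>"
    unfolding S_def using bessel_summable[OF orth] by simp
  have "1 \<le> S + \<epsilon>" if \<epsilon>: "\<epsilon> > 0" for \<epsilon>
  proof -
    obtain F c where F: "finite F" "F \<subseteq> \<Lambda>"
      "(LINT x|M. (norm (character y x - (\<Sum>i\<in>F. c i * character i x)))\<^sup>2) < \<epsilon>"
      using L2_approximableD[OF approx \<epsilon>] by blast
    have "1 - (\<Sum>i\<in>F. (norm (fourier M (y - i)))\<^sup>2)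
        + (\<Sum>i\<in>F. (norm (c i - fourier M (y - i)))\<^sup>2) < \<epsilon>"
      using F orth by (subst character_dist_sum[symmetric]) (auto simp: orthogonal_characters_def)
    moreover have "0 \<le> (\<Sum>i\<in>F. (norm (c i - fourier M (y - i)))\<^sup>2)"
      by (intro sum_nonneg) auto
    moreover have "(\<Sum>i\<in>F. (norm (fourier M (y - i)))\<^sup>2) \<le> S"
      using F by (intro finite_sum_le_has_sum[OF S]) auto
    ultimately show ?thesis by linarith
  qed
  then have "1 \<le> S"
    by (rule field_le_epsilon)
  moreover have "S \<le> 1"
    unfolding S_def by (rule bessel[OF orth])
  ultimately show ?thesis using S by simp
qed

lemma approximable_of_parseval:
  assumes orth: "orthogonal_characters M \<Lambda>"
    and sum: "((\<lambda>i. (norm (fourier M (y - i)))\<^sup>2) has_sum 1) \<Lambda>"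
  shows "L2_approximable M \<Lambda> character (character y)"
  unfolding L2_approximable_def
proof (intro allI impI)
  fix \<epsilon> :: real assume "\<epsilon> > 0"
  with sum have "\<forall>\<^sub>F F in finite_subsets_at_top \<Lambda>.
      dist (\<Sum>i\<in>F. (norm (fourier M (y - i)))\<^sup>2) 1 < \<epsilon>"
    unfolding has_sum_def by (rule tendstoD)
  then obtain F where F: "finite F" "F \<subseteq> \<Lambda>"
    "dist (\<Sum>i\<in>F. (norm (fourier M (y - i)))\<^sup>2) 1 < \<epsilon>"
    unfolding eventually_finite_subsets_at_top by blast
  then have "1 - (\<Sum>i\<in>F. (norm (fourier M (y - i)))\<^sup>2) < \<epsilon>"
    by (simp add: dist_real_def)
  then have "(LINT x|M. (norm (character y x - (\<Sum>i\<in>F. fourier M (y - i) * character i x)))\<^sup>2) < \<epsilon>"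
    using F orth by (subst character_dist_sum) (auto simp: orthogonal_characters_def)
  then show "\<exists>F c. finite F \<and> F \<subseteq> \<Lambda> \<and>
      (LINT x|M. (norm (character y x - (\<Sum>i\<in>F. c i * character i x)))\<^sup>2) < \<epsilon>"
    using F(1,2) by (intro exI[of _ F] exI[of _ "\<lambda>i. fourier M (y - i)"]) simp
qed

section \<open>Spectra: reformulation, nonemptiness, maximality\<close>

lemma is_spectrum_iff:
  "is_spectrum M \<Lambda> \<longleftrightarrow> countable \<Lambda> \<and> topological_space_class.discrete \<Lambda> \<and>
     orthogonal_characters M \<Lambda> \<and> (\<forall>f. square_integrable M f \<longrightarrow> L2_approximable M \<Lambda> character f)"
proof -
  have "(LINT x|M. (norm (character i x))\<^sup>2) \<noteq> 0" for i
    using prob_space by simp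
  then show ?thesis
    unfolding is_spectrum_def orthogonal_L2_basis_def orthogonal_characters_def
      L2_approximable_def character_def[symmetric] character_mult_cnj fourier_def[symmetric]
    by auto
qed

lemma spectrum_nonempty:
  assumes "is_spectrum M \<Lambda>"
  shows "\<Lambda> \<noteq> {}"
proof
  assume "\<Lambda> = {}"
  then have "L2_approximable M {} character (character 0)"
    using assms character_square_integrable[of 0] unfolding is_spectrum_iff by blast
  then show False
    using prob_space unfolding L2_approximable_def by (auto dest: spec[of _ "1/2"])
qed

text \<open>A further frequency \<open>y\<close> would have only zero Fourier coefficients along
  \<Lambda>, while Parseval requires their squares to sum to 1.\<close>

lemma spectrum_maximal:
  assumes "is_spectrum M \<Lambda>" "orthogonal_characters M \<Lambda>'" "\<Lambda> \<subseteq> \<Lambda>'"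
  shows "\<Lambda>' = \<Lambda>"
proof (rule ccontr)
  assume "\<Lambda>' \<noteq> \<Lambda>"
  then obtain y where y: "y \<in> \<Lambda>'" "y \<notin> \<Lambda>"
    using assms(3) by auto
  have "((\<lambda>i. (norm (fourier M (y - i)))\<^sup>2) has_sum 1) \<Lambda>"
    using assms(1) by (intro parseval_of_approximable) (auto simp: is_spectrum_iff)
  moreover have "((\<lambda>i. (norm (fourier M (y - i)))\<^sup>2) has_sum 0) \<Lambda>"
  proof (rule has_sum_0)
    fix i assume "i \<in> \<Lambda>"
    with y have "i \<in> \<Lambda>'" "y \<noteq> i" using assms(3) by auto
    then show "(norm (fourier M (y - i)))\<^sup>2 = 0"
      using assms(2) y(1) by (simp add: orthogonal_characters_def)
  qed
  ultimately show False
    using has_sum_unique by force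
qed

lemma character_L2_continuous:
  assumes "X \<longlonglongrightarrow> l"
  shows "(\<lambda>n. LINT x|M. (norm (character l x - character (X n) x))\<^sup>2) \<longlonglongrightarrow> 0"
proof -
  have "(\<lambda>n. LINT x|M. (norm (character l x - character (X n) x))\<^sup>2) \<longlonglongrightarrow> (LINT x|M. 0)"
  proof (rule integral_dominated_convergence[where w="\<lambda>_. 4"])
    show "AE x in M. (\<lambda>n. (norm (character l x - character (X n) x))\<^sup>2) \<longlonglongrightarrow> 0"
    proof (rule AE_I2)
      fix x
      have "(\<lambda>n. (norm (character l x - character (X n) x))\<^sup>2) \<longlonglongrightarrow> (norm (character l x - character l x))\<^sup>2"
        unfolding character_def by (intro tendsto_intros assms)
      then show "(\<lambda>n. (norm (character l x - character (X n) x))\<^sup>2) \<longlonglongrightarrow> 0" by simp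
    qed
    show "AE x in M. norm ((norm (character l x - character (X n) x))\<^sup>2) \<le> 4" for n
    proof (intro AE_I2)
      fix x
      have "norm (character l x - character (X n) x) \<le> 2"
        using norm_triangle_ineq4[of "character l x" "character (X n) x"] by simp
      from power_mono[OF this, of 2] show "norm ((norm (character l x - character (X n) x))\<^sup>2) \<le> 4" by simp
    qed
  qed auto
  then show ?thesis by simp
qed

text \<open>The complement of a countable set is dense, and characters depend continuously in L2 on
  the frequency. This covers the exceptional frequencies at which the Parseval argument is not
  run.\<close>

lemma approximable_of_dense:
  assumes D: "countable (UNIV - D)" and approx: "\<And>y. y \<in> D \<Longrightarrow> L2_approximable M \<Lambda> character (character y)"
  shows "L2_approximable M \<Lambda> character (character l)"
proof (rule L2_approximable_closed)
  fix \<epsilon> :: real assume "\<epsilon> > 0"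
  have "\<exists>y. y \<in> D \<and> dist y l < 1 / Suc n" for n
    using open_minus_countable[OF D, of "ball l (1 / Suc n)"]
    by (auto simp: dist_commute)
  then obtain X where X: "\<And>n. X n \<in> D" "\<And>n. dist (X n) l < 1 / Suc n"
    by metis
  have "X \<longlonglongrightarrow> l"
  proof (rule metric_LIMSEQ_I)
    fix r :: real assume "r > 0"
    then obtain N where N: "1 / Suc N < r"
      using nat_approx_posE by blast
    have "dist (X n) l < r" if "n \<ge> N" for n
    proof -
      have "1 / real (Suc n) \<le> 1 / real (Suc N)"
        using that by (intro divide_left_mono) auto
      then show ?thesis using X(2)[of n] N by linarith
    qed
    then show "\<exists>no. \<forall>n\<ge>no. dist (X n) l < r" by auto
  qed
  from order_tendstoD(2)[OF character_L2_continuous[OF this] \<open>\<epsilon> > 0\<close>]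
  obtain n where "(LINT x|M. (norm (character l x - character (X n) x))\<^sup>2) < \<epsilon>"
    by (auto simp: eventually_sequentially)
  then show "\<exists>g. square_integrable M g \<and> L2_approximable M \<Lambda> character g \<and>
      (LINT x|M. (norm (character l x - g x))\<^sup>2) < \<epsilon>"
    using X(1) approx by (intro exI[of _ "character (X n)"]) auto
qed auto

end

section \<open>Convolution with a uniform measure on an arithmetic progression\<close>

lemma real_distribution_dirac_average: "real_distribution (dirac_average E)"
  unfolding dirac_average_def
  by (rule prob_space.real_distribution_distr[OF prob_space_measure_pmf]) simp

lemma real_distribution_convolution:
  assumes "real_distribution M" "real_distribution N"
  shows "real_distribution (M \<star> N)"
proof -
  interpret M: real_distribution M by fact
  interpret N: real_distribution N by fact
  interpret MN: pair_prob_space M N ..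
  have "prob_space (M \<star> N)"
    unfolding convolution_def by (rule MN.P.prob_space_distr) simp
  then show ?thesis
    by (simp add: real_distribution_def real_distribution_axioms_def)
qed

lemma fourier_convolution:
  assumes "real_distribution M" "real_distribution N"
  shows "fourier (M \<star> N) l = fourier M l * fourier N l"
proof -
  interpret M: real_distribution M by fact
  interpret N: real_distribution N by fact
  interpret MN: pair_prob_space M N ..
  have int: "integrable (M \<Otimes>\<^sub>M N) (\<lambda>z. character l (fst z) * character l (snd z))"
    by (rule MN.P.integrable_const_bound[of _ 1]) (auto simp: norm_mult)
  have "fourier (M \<star> N) l = (LINT z|(M \<Otimes>\<^sub>M N). character l (fst z) * character l (snd z))"
    unfolding fourier_def convolution_def
    by (subst integral_distr) (auto simp: character_add_right split_beta)
  also have "\<dots> = (LINT x|M. LINT y|N. character l x * character l y)"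
    using MN.integral_fst'[OF int] by simp
  also have "\<dots> = fourier M l * fourier N l"
    by (simp add: fourier_def)
  finally show ?thesis .
qed

lemma fourier_dirac_average:
  assumes "finite E" "E \<noteq> {}"
  shows "fourier (dirac_average E) l = (\<Sum>e\<in>E. character l e) / of_nat (card E)"
proof -
  have "fourier (dirac_average E) l = measure_pmf.expectation (pmf_of_set E) (character l)"
    unfolding fourier_def dirac_average_def by (simp add: integral_distr)
  also have "\<dots> = (\<Sum>e\<in>E. pmf (pmf_of_set E) e *\<^sub>R character l e)"
    using assms by (intro integral_measure_pmf) auto
  also have "\<dots> = (\<Sum>e\<in>E. character l e) / of_nat (card E)"
    using assms by (simp add: scaleR_conv_of_real sum_divide_distrib)
  finally show ?thesis .
qed

text \<open>The convolution is the average of the translates of \<nu> by the points of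
  \<open>E\<close>, and 0 in \<open>E\<close> makes \<nu> itself one of them. Hence \<nu> is at most
  \<open>card E\<close> times the convolution; completeness and compact support both pass to \<nu>
  through this bound.\<close>

lemma nn_integral_le_dirac_average_convolution:
  assumes \<nu>: "real_distribution \<nu>" and E: "finite E" "0 \<in> E"
    and [measurable]: "f \<in> borel_measurable borel"
  shows "(\<integral>\<^sup>+x. f x \<partial>\<nu>) \<le> of_nat (card E) * (\<integral>\<^sup>+x. f x \<partial>(dirac_average E \<star> \<nu>))"
proof -
  interpret \<nu>: real_distribution \<nu> by fact
  interpret D: real_distribution "dirac_average E" by (rule real_distribution_dirac_average)
  define g where "g x = (\<integral>\<^sup>+y. f (x + y) \<partial>\<nu>)" for x
  have [measurable]: "g \<in> borel_measurable borel"
    unfolding g_def by measurable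
  have ne: "E \<noteq> {}" using E by auto
  have card: "card E > 0" using E by (auto simp: card_gt_0_iff)
  have "(\<integral>\<^sup>+x. f x \<partial>(dirac_average E \<star> \<nu>)) = (\<integral>\<^sup>+x. g x \<partial>dirac_average E)"
    unfolding g_def
    by (subst nn_integral_convolution) (auto simp: D.finite_measure_axioms \<nu>.finite_measure_axioms)
  also have "\<dots> = (\<integral>\<^sup>+x. g x \<partial>measure_pmf (pmf_of_set E))"
    unfolding dirac_average_def by (subst nn_integral_distr) auto
  also have "\<dots> = (\<Sum>e\<in>E. g e) / of_nat (card E)"
    using E ne by (simp add: nn_integral_pmf_of_set)
  finally have *: "of_nat (card E) * (\<integral>\<^sup>+x. f x \<partial>(dirac_average E \<star> \<nu>)) = (\<Sum>e\<in>E. g e)"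
    using card by (simp add: ennreal_times_divide ennreal_mult_divide_eq mult.commute ennreal_of_nat_eq_real_of_nat)
  have "(\<integral>\<^sup>+x. f x \<partial>\<nu>) = g 0"
    by (simp add: g_def)
  also have "\<dots> \<le> (\<Sum>e\<in>E. g e)"
    using E by (intro member_le_sum) auto
  finally show ?thesis using * by simp
qed

lemma square_integrable_dirac_average_convolution:
  assumes \<nu>: "real_distribution \<nu>" and E: "finite E" "0 \<in> E"
    and f: "square_integrable (dirac_average E \<star> \<nu>) f"
  shows "square_integrable \<nu> f"
    and "(LINT x|\<nu>. (norm (f x))\<^sup>2)
      \<le> real (card E) * (LINT x|(dirac_average E \<star> \<nu>). (norm (f x))\<^sup>2)"
proof -
  interpret \<nu>: real_distribution \<nu> by fact
  let ?\<mu> = "dirac_average E \<star> \<nu>"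
  have [measurable]: "f \<in> borel_measurable borel" and int: "integrable ?\<mu> (\<lambda>x. (norm (f x))\<^sup>2)"
    using f by (auto simp: square_integrable_def)
  have nn: "(\<integral>\<^sup>+x. ennreal ((norm (f x))\<^sup>2) \<partial>\<nu>)
      \<le> ennreal (real (card E) * (LINT x|?\<mu>. (norm (f x))\<^sup>2))"
    using nn_integral_le_dirac_average_convolution[OF \<nu> E, of "\<lambda>x. ennreal ((norm (f x))\<^sup>2)"]
      nn_integral_eq_integral[OF int]
    by (simp add: ennreal_mult ennreal_of_nat_eq_real_of_nat)
  then have int\<nu>: "integrable \<nu> (\<lambda>x. (norm (f x))\<^sup>2)"
    by (intro integrableI_bounded) (auto simp: le_less_trans)
  then show "square_integrable \<nu> f"
    by (simp add: square_integrable_def)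
  show "(LINT x|\<nu>. (norm (f x))\<^sup>2) \<le> real (card E) * (LINT x|?\<mu>. (norm (f x))\<^sup>2)"
    using nn nn_integral_eq_integral[OF int\<nu>] by (simp add: ennreal_le_iff)
qed

text \<open>Summation over the fibres of \<pi>. It serves twice: for the partition of \<Lambda> into
  cosets of \<open>G\<close>, and for that of one coset into residues modulo
  \<open>H\<close>.\<close>

lemma has_sum_group:
  fixes f :: "'a \<Rightarrow> real"
  assumes f: "(f has_sum s) B" and \<pi>: "\<pi> ` B \<subseteq> A"
  shows "((\<lambda>\<alpha>. \<Sum>\<^sub>\<infinity>x\<in>{x\<in>B. \<pi> x = \<alpha>}. f x) has_sum s) A"
proof (rule has_sum_Sigma[OF isUCont_plus])
  let ?S = "Sigma A (\<lambda>\<alpha>. {x \<in> B. \<pi> x = \<alpha>})"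
  have inj: "inj_on snd ?S"
    by (rule inj_onI) auto
  have img: "snd ` ?S = B"
    using \<pi> by (auto simp: image_iff)
  have "((f \<circ> snd) has_sum s) ?S"
    unfolding has_sum_reindex[OF inj, symmetric] img by (rule f)
  then show "((\<lambda>z. f (snd z)) has_sum s) ?S"
    by (simp only: o_def)
  fix \<alpha>
  have "f summable_on {x \<in> B. \<pi> x = \<alpha>}"
    by (rule summable_on_subset_banach[OF has_sum_imp_summable[OF f]]) auto
  then show "((\<lambda>x. f (snd (\<alpha>, x))) has_sum (\<Sum>\<^sub>\<infinity>x\<in>{x\<in>B. \<pi> x = \<alpha>}. f x)) {x \<in> B. \<pi> x = \<alpha>}"
    by simp
qed

definition progression :: "nat \<Rightarrow> real \<Rightarrow> real set" where
  "progression P t = (\<lambda>j. real j * t) ` {..<P}"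

lemma finite_progression [simp]: "finite (progression P t)"
  by (simp add: progression_def)

lemma zero_in_progression: "P > 0 \<Longrightarrow> 0 \<in> progression P t"
  by (auto simp: progression_def intro!: image_eqI[of _ _ 0])

lemma card_progression: "t \<noteq> 0 \<Longrightarrow> card (progression P t) = P"
  by (simp add: progression_def card_image inj_on_def)

lemma cis_2pi_eq_1_iff: "cis (2 * pi * x) = 1 \<longleftrightarrow> x \<in> \<int>"
proof
  assume "cis (2 * pi * x) = 1"
  then obtain n :: int where "2 * pi * x = of_int (2 * n) * pi"
    by (auto simp: cis_conv_exp exp_eq_1)
  then have "x = of_int n" by simp
  then show "x \<in> \<int>" by simp
qed (rule cis_multiple_2pi)

section \<open>Zeros and periods of the Fourier transform of the uniform measure on a
  progression\<close>

locale progression_mask =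
  fixes P :: nat and t :: real
  assumes P: "P > 0" and t: "t \<noteq> 0"
begin

abbreviation D :: "real measure" where
  "D \<equiv> dirac_average (progression P t)"

definition G :: "real set" where
  "G = {l. l * P * t \<in> \<int>}"

definition H :: "real set" where
  "H = {l. l * t \<in> \<int>}"

lemma G_minus: "x \<in> G \<Longrightarrow> - x \<in> G"
  by (simp add: G_def)

lemma G_add: "x \<in> G \<Longrightarrow> y \<in> G \<Longrightarrow> x + y \<in> G"
  by (simp add: G_def distrib_right)

lemma H_minus: "x \<in> H \<Longrightarrow> - x \<in> H"
  by (simp add: H_def)

lemma H_add: "x \<in> H \<Longrightarrow> y \<in> H \<Longrightarrow> x + y \<in> H"
  by (simp add: H_def distrib_right)

lemma countable_G: "countable G"
proof -
  have "G \<subseteq> (\<lambda>n. of_int n / (P * t)) ` (UNIV :: int set)"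
    using P t by (auto simp: G_def field_simps elim!: Ints_cases intro!: image_eqI)
  then show ?thesis
    by (rule countable_subset) simp
qed

lemma real_distribution_D: "real_distribution D"
  by (rule real_distribution_dirac_average)

lemma fourier_D: "fourier D l = (\<Sum>j<P. character l t ^ j) / of_nat P"
proof -
  have "(\<Sum>e\<in>progression P t. character l e) = (\<Sum>j<P. character l (real j * t))"
    unfolding progression_def using t by (subst sum.reindex) (auto simp: inj_on_def)
  also have "\<dots> = (\<Sum>j<P. character l t ^ j)"
    by (simp add: character_eq_cis Complex.DeMoivre mult_ac)
  finally show ?thesis
    using zero_in_progression[OF P, of t] by (subst fourier_dirac_average) (auto simp: card_progression t)
qed

lemma character_eq_1_iff: "character l t = 1 \<longleftrightarrow> l \<in> H"
  by (simp add: character_eq_cis cis_2pi_eq_1_iff[symmetric] H_def mult_ac)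

lemma character_power_eq_1_iff: "character l t ^ P = 1 \<longleftrightarrow> l \<in> G"
  by (simp add: character_eq_cis cis_2pi_eq_1_iff[symmetric] G_def Complex.DeMoivre mult_ac)

lemma fourier_D_add_H: "h \<in> H \<Longrightarrow> fourier D (l + h) = fourier D l"
  using character_eq_1_iff[of h] by (simp add: fourier_D character_add)

lemma fourier_D_H: "h \<in> H \<Longrightarrow> fourier D h = 1"
  using P character_eq_1_iff[of h] by (simp add: fourier_D)

text \<open>The transform is a geometric sum with ratio \<open>character l t\<close>; its closed
  form has a numerator vanishing on \<open>G\<close> and a denominator vanishing on
  \<open>H\<close>.\<close>

lemma fourier_D_eq_0_iff: "fourier D l = 0 \<longleftrightarrow> l \<in> G - H"
proof (cases "l \<in> H")
  case False
  then have "character l t \<noteq> 1" by (simp add: character_eq_1_iff)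
  from geometric_sum[OF this, of P] this P show ?thesis
    using False by (simp add: fourier_D character_power_eq_1_iff)
qed (simp add: fourier_D_H)

lemma step_in_G: "real k / (P * t) \<in> G"
  using P t by (simp add: G_def)

lemma step_diff_in_H:
  assumes "k < P" "k' < P" "real k / (P * t) - real k' / (P * t) \<in> H"
  shows "k = k'"
proof -
  obtain n :: int where "(real k / (P * t) - real k' / (P * t)) * t = of_int n"
    using assms(3) by (auto simp: H_def elim!: Ints_cases)
  then have "(real k - real k') / P = of_int n"
    using t by (simp add: diff_divide_distrib left_diff_distrib)
  then have "real_of_int (int k - int k') = of_int (int P * n)"
    using P by (simp add: field_simps)
  then have *: "int k - int k' = int P * n"
    by (simp only: of_int_eq_iff)
  have "\<bar>int k - int k'\<bar> < int P"
    using assms(1,2) by linarith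
  then have "n = 0"
    unfolding * using P by (simp add: abs_mult)
  then show ?thesis using * by simp
qed

text \<open>The points \<open>real k / (P * t)\<close> represent the classes of \<open>G\<close>
  modulo \<open>H\<close>, so their characters are orthogonal in L2 of \<open>D\<close>, and this is
  the Bessel inequality for \<open>D\<close> itself.\<close>

lemma sum_fourier_D_le_1:
  "(\<Sum>k<P. (norm (fourier D (x - real k / (P * t))))\<^sup>2) \<le> 1"
proof -
  interpret D: real_distribution D by (rule real_distribution_D)
  define F where "F = (\<lambda>k. real k / (P * t)) ` {..<P}"
  have inj: "inj_on (\<lambda>k. real k / (P * t)) {..<P}"
    using P t by (auto simp: inj_on_def)
  have "orthogonal_characters D F"
    unfolding orthogonal_characters_def
  proof (intro ballI impI)
    fix i j assume "i \<in> F" "j \<in> F" "i \<noteq> j"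
    then obtain k k' where k: "k < P" "k' < P" "k \<noteq> k'" "i = real k / (P * t)" "j = real k' / (P * t)"
      unfolding F_def by blast
    have "i - j \<in> G"
      unfolding k diff_conv_add_uminus by (intro G_add G_minus step_in_G)
    moreover have "i - j \<notin> H"
      using step_diff_in_H k by blast
    ultimately show "fourier D (i - j) = 0"
      by (simp add: fourier_D_eq_0_iff)
  qed
  then have "(\<Sum>i\<in>F. (norm (fourier D (x - i)))\<^sup>2) \<le> 1"
    by (rule D.bessel_finite) (auto simp: F_def)
  then show ?thesis
    by (simp add: F_def sum.reindex[OF inj])
qed

section \<open>Selections of one residue class in each coset\<close>

definition coset_rep :: "(real \<Rightarrow> real) \<Rightarrow> bool" where
  "coset_rep \<rho> \<longleftrightarrow> (\<forall>x. \<rho> x - x \<in> G) \<and> (\<forall>x y. x - y \<in> G \<longrightarrow> \<rho> x = \<rho> y)"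

text \<open>A class modulo \<open>H\<close> in every coset of \<open>G\<close> is encoded by one
  real function \<rho> that is constant on cosets: the chosen class is the one containing the
  representative.\<close>

definition selection :: "(real \<Rightarrow> real) \<Rightarrow> real set \<Rightarrow> real set" where
  "selection \<rho> \<Lambda> = {l \<in> \<Lambda>. l - \<rho> l \<in> H}"

text \<open>The shift \<open>d\<close> is evaluated at the representative \<open>\<rho> x\<close>,
  not at \<open>x\<close>, which keeps the sum constant on cosets. In this way any prescribed class
  is reached from a given \<rho>.\<close>

lemma coset_rep_add:
  assumes "coset_rep \<rho>" "\<And>x. d x \<in> G"
  shows "coset_rep (\<lambda>x. \<rho> x + d (\<rho> x))"
  unfolding coset_rep_def
proof (intro conjI allI impI)
  fix x
  have "\<rho> x - x + d (\<rho> x) \<in> G"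
    using assms by (intro G_add) (auto simp: coset_rep_def)
  then show "\<rho> x + d (\<rho> x) - x \<in> G" by (simp add: algebra_simps)
next
  fix x y assume "x - y \<in> G"
  then have "\<rho> x = \<rho> y" using assms(1) by (simp add: coset_rep_def)
  then show "\<rho> x + d (\<rho> x) = \<rho> y + d (\<rho> y)" by simp
qed

text \<open>In the coordinate \<open>x * P * t\<close> the group \<open>G\<close> becomes the
  integers, and the fractional part is an explicit representative.\<close>

lemma coset_rep_frac: "coset_rep (\<lambda>x. frac (x * P * t) / (P * t))"
  unfolding coset_rep_def
proof (intro conjI allI impI)
  fix x :: real
  have "(frac (x * P * t) / (P * t) - x) * P * t = frac (x * P * t) - x * P * t"
    using P t by (simp add: left_diff_distrib)
  also have "\<dots> = - of_int \<lfloor>x * P * t\<rfloor>"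
    by (simp add: frac_def)
  finally have "(frac (x * P * t) / (P * t) - x) * P * t = - of_int \<lfloor>x * P * t\<rfloor>" .
  then show "frac (x * P * t) / (P * t) - x \<in> G"
    by (simp add: G_def)
next
  fix x y assume "x - y \<in> G"
  then have "x * P * t - y * P * t \<in> \<int>"
    by (simp add: G_def left_diff_distrib)
  then obtain n where "x * P * t - y * P * t = of_int n"
    by (rule Ints_cases)
  then have n: "x * P * t = y * P * t + of_int n"
    by linarith
  have "frac (x * P * t) = frac (y * P * t)"
    unfolding n by (simp add: frac_def)
  then show "frac (x * P * t) / (P * t) = frac (y * P * t) / (P * t)" by simp
qed

lemma coset_rep_update:
  assumes "coset_rep \<rho>" "c - z \<in> G"
  shows "coset_rep (\<lambda>x. if x - z \<in> G then c else \<rho> x)"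
proof -
  have mem: "x - z \<in> G \<longleftrightarrow> y - z \<in> G" if "x - y \<in> G" for x y
    using G_add[OF that, of "y - z"] G_add[OF G_minus[OF that], of "x - z"] by auto
  have "c - x \<in> G" if "x - z \<in> G" for x
    using G_add[OF assms(2) G_minus[OF that]] by simp
  moreover have "(if x - z \<in> G then c else \<rho> x) = (if y - z \<in> G then c else \<rho> y)"
    if "x - y \<in> G" for x y
    using mem[OF that] that assms(1) by (simp add: coset_rep_def)
  ultimately show ?thesis
    using assms(1) by (simp add: coset_rep_def)
qed

text \<open>The transform of the convolution is a product. Two selected points in the same coset of
  \<open>G\<close> are congruent modulo \<open>H\<close>, so the factor of \<open>D\<close> is
  nonzero at their difference and the zero has to come from \<nu>.\<close>

lemma orthogonal_selection:
  assumes \<nu>: "real_distribution \<nu>" and orth: "orthogonal_characters (D \<star> \<nu>) \<Lambda>"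
    and \<rho>: "coset_rep \<rho>"
  shows "orthogonal_characters \<nu> (selection \<rho> \<Lambda>)"
  unfolding orthogonal_characters_def
proof (intro ballI impI)
  fix i j assume ij: "i \<in> selection \<rho> \<Lambda>" "j \<in> selection \<rho> \<Lambda>" "i \<noteq> j"
  then have "fourier D (i - j) * fourier \<nu> (i - j) = 0"
    using orth by (auto simp: orthogonal_characters_def selection_def
        fourier_convolution[OF real_distribution_D \<nu>])
  moreover have "fourier D (i - j) \<noteq> 0"
  proof
    assume "fourier D (i - j) = 0"
    then have "i - j \<in> G" "i - j \<notin> H"
      by (auto simp: fourier_D_eq_0_iff)
    then have "\<rho> i = \<rho> j"
      using \<rho> by (simp add: coset_rep_def)
    then have "i - j \<in> H"
      using ij H_add[of "i - \<rho> i" "- (j - \<rho> j)"] H_minus[of "j - \<rho> j"]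
      by (simp add: selection_def)
    with \<open>i - j \<notin> H\<close> show False ..
  qed
  ultimately show "fourier \<nu> (i - j) = 0" by simp
qed

lemma ex_residue:
  assumes "x \<in> G"
  shows "\<exists>k<P. x - real k / (P * t) \<in> H"
proof -
  obtain n where n: "x * P * t = of_int n"
    using assms by (auto simp: G_def elim!: Ints_cases)
  define k where "k = nat (n mod int P)"
  have k: "int k = n mod int P" "k < P"
    using P by (auto simp: k_def nat_less_iff)
  have "n = int P * (n div int P) + int k"
    unfolding k by simp
  then have "real_of_int n = real P * of_int (n div int P) + real k"
    by (metis of_int_add of_int_mult of_int_of_nat_eq)
  then have "real P * ((x - real k / (P * t)) * t) = real P * of_int (n div int P)"
    using P t n by (simp add: algebra_simps)
  then have "(x - real k / (P * t)) * t = of_int (n div int P)"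
    using P by simp
  then show ?thesis
    using k by (auto simp: H_def)
qed

text \<open>The Parseval sum over \<open>\<Lambda>\<close>, grouped by cosets of \<open>G\<close>, is a sum of weighted averages over the
  residues modulo \<open>H\<close>. Choosing a residue of maximal weight in each coset still gives an orthogonal
  family for \<open>\<nu>\<close>, so by the Bessel inequality all residues have the same weight.\<close>

lemma selection_parseval:
  assumes \<nu>: "real_distribution \<nu>" and orth: "orthogonal_characters (D \<star> \<nu>) \<Lambda>"
    and \<rho>: "coset_rep \<rho>" and y: "\<And>l. l \<in> \<Lambda> \<Longrightarrow> y - l \<notin> G"
    and sum: "((\<lambda>l. (norm (fourier (D \<star> \<nu>) (y - l)))\<^sup>2) has_sum 1) \<Lambda>"
  shows "((\<lambda>l. (norm (fourier \<nu> (y - l)))\<^sup>2) has_sum 1) (selection \<rho> \<Lambda>)"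
proof -
  interpret \<nu>: real_distribution \<nu> by fact
  define a where "a = 1 / (P * t)"
  define q where "q l = (norm (fourier \<nu> (y - l)))\<^sup>2" for l
  define w where "w l = (norm (fourier D (y - l)))\<^sup>2" for l
  define A where "A = \<rho> ` \<Lambda>"
  define C where "C \<alpha> k = {l \<in> \<Lambda>. \<rho> l = \<alpha> \<and> l - \<alpha> - real k * a \<in> H}" for \<alpha> k
  define Q where "Q \<alpha> k = (\<Sum>\<^sub>\<infinity>l\<in>C \<alpha> k. q l)" for \<alpha> k
  define W where "W \<alpha> k = (norm (fourier D (y - \<alpha> - real k * a)))\<^sup>2" for \<alpha> k
  \<comment> \<open>\<phi> prescribes a class \<open>\<phi> \<alpha>\<close> for each coset;
    shifting \<rho> accordingly makes this a selection again, to which the orthogonality in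
    L2(\<nu>) applies.\<close>
  define S where "S \<phi> = selection (\<lambda>x. \<rho> x + real (\<phi> (\<rho> x)) * a) \<Lambda>" for \<phi> :: "real \<Rightarrow> nat"

  have step: "real k * a \<in> G" for k
    using step_in_G[of k] by (simp add: a_def)
  have orth_S: "orthogonal_characters \<nu> (S \<phi>)" for \<phi>
    unfolding S_def using step
    by (intro orthogonal_selection[OF \<nu> orth] coset_rep_add[OF \<rho>, of "\<lambda>x. real (\<phi> x) * a"])
  have C_eq: "{l \<in> S \<phi>. \<rho> l = \<alpha>} = C \<alpha> (\<phi> \<alpha>)" for \<phi> \<alpha>
    by (auto simp: S_def C_def selection_def diff_diff_eq)
  have q_S: "q summable_on S \<phi>" for \<phi>
    unfolding q_def using \<nu>.bessel_summable[OF orth_S] .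
  have Q_sum: "((\<lambda>\<alpha>. Q \<alpha> (\<phi> \<alpha>)) has_sum infsum q (S \<phi>)) A" for \<phi>
  proof -
    have "\<rho> ` S \<phi> \<subseteq> A"
      by (auto simp: A_def S_def selection_def)
    from has_sum_group[OF has_sum_infsum[OF q_S] this] show ?thesis
      by (simp add: C_eq Q_def)
  qed
  \<comment> \<open>Class \<open>k\<close> of the coset of \<alpha> is part of the selection that
    takes class \<open>k\<close> everywhere.\<close>
  have q_C: "q summable_on C \<alpha> k" for \<alpha> k
    using C_eq[of "\<lambda>_. k" \<alpha>] by (intro summable_on_subset_banach[OF q_S[of "\<lambda>_. k"]]) auto
  have Q_nonneg: "0 \<le> Q \<alpha> k" for \<alpha> k
    unfolding Q_def by (intro infsum_nonneg) (simp add: q_def)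

  define T where "T \<alpha> = (\<Sum>\<^sub>\<infinity>l\<in>{l\<in>\<Lambda>. \<rho> l = \<alpha>}. w l * q l)" for \<alpha>
  have wq: "((\<lambda>l. w l * q l) has_sum 1) \<Lambda>"
    using sum unfolding fourier_convolution[OF real_distribution_D \<nu>] w_def q_def
    by (simp add: norm_mult power_mult_distrib)
  have T_sum: "(T has_sum 1) A"
    unfolding T_def by (rule has_sum_group[OF wq]) (simp add: A_def)
  have T_eq: "T \<alpha> = (\<Sum>k<P. W \<alpha> k * Q \<alpha> k)" for \<alpha>
  proof -
    let ?B = "{l\<in>\<Lambda>. \<rho> l = \<alpha>}"
    have "\<exists>k<P. l - \<alpha> - real k * a \<in> H" if "l \<in> ?B" for l
    proof -
      have "l - \<alpha> \<in> G"
        using that \<rho> G_minus[of "\<rho> l - l"] by (auto simp: coset_rep_def)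
      from ex_residue[OF this] show ?thesis by (simp add: a_def)
    qed
    then obtain \<kappa> where \<kappa>: "\<And>l. l \<in> ?B \<Longrightarrow> \<kappa> l < P \<and> l - \<alpha> - real (\<kappa> l) * a \<in> H"
      by metis
    have C: "{l \<in> ?B. \<kappa> l = k} = C \<alpha> k" if "k < P" for k
    proof -
      have "\<kappa> l = k" if "l \<in> ?B" "l - \<alpha> - real k * a \<in> H" for l
      proof (rule step_diff_in_H)
        show "\<kappa> l < P" "k < P"
          using \<kappa>[OF that(1)] \<open>k < P\<close> by auto
        have "(l - \<alpha> - real k * a) + - (l - \<alpha> - real (\<kappa> l) * a) \<in> H"
          using \<kappa>[OF that(1)] that(2) by (intro H_add H_minus) auto
        then show "real (\<kappa> l) / (P * t) - real k / (P * t) \<in> H"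
          by (simp add: a_def)
      qed
      then show ?thesis
        using \<kappa> by (auto simp: C_def)
    qed
    have "(\<lambda>l. w l * q l) summable_on ?B"
      by (rule summable_on_subset_banach[OF has_sum_imp_summable[OF wq]]) auto
    then have "((\<lambda>l. w l * q l) has_sum T \<alpha>) ?B"
      unfolding T_def by simp
    from has_sum_group[OF this, of \<kappa> "{..<P}"] \<kappa>
    have "((\<lambda>k. \<Sum>\<^sub>\<infinity>l\<in>{l\<in>?B. \<kappa> l = k}. w l * q l) has_sum T \<alpha>) {..<P}"
      by auto
    then have "T \<alpha> = (\<Sum>k<P. \<Sum>\<^sub>\<infinity>l\<in>{l\<in>?B. \<kappa> l = k}. w l * q l)"
      by (rule has_sum_unique) simp
    also have "\<dots> = (\<Sum>k<P. W \<alpha> k * Q \<alpha> k)"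
    proof (intro sum.cong refl)
      fix k assume k: "k \<in> {..<P}"
      have "(\<Sum>\<^sub>\<infinity>l\<in>{l\<in>?B. \<kappa> l = k}. w l * q l) = (\<Sum>\<^sub>\<infinity>l\<in>C \<alpha> k. W \<alpha> k * q l)"
      proof (rule infsum_cong_neutral)
        \<comment> \<open>On \<open>C \<alpha> k\<close> the points agree with
          \<open>\<alpha> + real k * a\<close> modulo \<open>H\<close>, and the transform of
          \<open>D\<close> is \<open>H\<close>-periodic, so the weight is constant there.\<close>
        fix l assume "l \<in> {l\<in>?B. \<kappa> l = k} \<inter> C \<alpha> k"
        then have "- (l - \<alpha> - real k * a) \<in> H"
          by (intro H_minus) (simp add: C_def)
        from fourier_D_add_H[OF this, of "y - \<alpha> - real k * a"]
        show "w l * q l = W \<alpha> k * q l"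
          by (simp add: w_def W_def)
      qed (use C k in auto)
      also have "\<dots> = W \<alpha> k * Q \<alpha> k"
        unfolding Q_def by (intro infsum_cmult_right q_C)
      finally show "(\<Sum>\<^sub>\<infinity>l\<in>{l\<in>?B. \<kappa> l = k}. w l * q l) = W \<alpha> k * Q \<alpha> k" .
    qed
    finally show ?thesis .
  qed
  have W_le: "(\<Sum>k<P. W \<alpha> k) \<le> 1" for \<alpha>
    using sum_fourier_D_le_1[of "y - \<alpha>"] by (simp add: W_def a_def)
  have W_nonneg: "0 \<le> W \<alpha> k" for \<alpha> k
    by (simp add: W_def)

  have "\<exists>k<P. \<forall>k'<P. Q \<alpha> k' \<le> Q \<alpha> k" for \<alpha>
  proof -
    have "Max (Q \<alpha> ` {..<P}) \<in> Q \<alpha> ` {..<P}"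
      using P by (intro Max_in) auto
    then obtain k where "k < P" "Max (Q \<alpha> ` {..<P}) = Q \<alpha> k" by auto
    then show ?thesis
      by (metis Max_ge finite_imageI finite_lessThan imageI lessThan_iff)
  qed
  then obtain \<phi> where \<phi>: "\<And>\<alpha>. \<phi> \<alpha> < P" "\<And>\<alpha> k. k < P \<Longrightarrow> Q \<alpha> k \<le> Q \<alpha> (\<phi> \<alpha>)"
    by metis
  define U where "U \<alpha> = Q \<alpha> (\<phi> \<alpha>)" for \<alpha>
  have U_sum: "(U has_sum infsum q (S \<phi>)) A"
    unfolding U_def by (rule Q_sum)
  have U_le: "infsum q (S \<phi>) \<le> 1"
    unfolding q_def by (rule \<nu>.bessel[OF orth_S])
  \<comment> \<open>The weights \<open>W\<close> sum to at most 1, so the weighted sum stays below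
    the largest \<open>Q\<close>.\<close>
  have T_le_U: "T \<alpha> \<le> U \<alpha>" for \<alpha>
  proof -
    have "T \<alpha> \<le> (\<Sum>k<P. W \<alpha> k * U \<alpha>)"
      unfolding T_eq U_def by (intro sum_mono mult_left_mono \<phi> W_nonneg) auto
    also have "\<dots> = (\<Sum>k<P. W \<alpha> k) * U \<alpha>"
      by (simp add: sum_distrib_right)
    also have "\<dots> \<le> 1 * U \<alpha>"
      using W_le Q_nonneg by (intro mult_right_mono) (auto simp: U_def)
    finally show ?thesis by simp
  qed
  \<comment> \<open>The \<open>T\<close> sum to 1 and the termwise larger \<open>U\<close> to at
    most 1, so no term can differ.\<close>
  have UT: "U \<alpha> = T \<alpha>" if "\<alpha> \<in> A" for \<alpha>
  proof -
    have UT_sum: "((\<lambda>\<alpha>. U \<alpha> - T \<alpha>) has_sum infsum q (S \<phi>) - 1) A"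
      using has_sum_add[OF U_sum has_sum_cmult_right[OF T_sum, of "-1"]] by simp
    then have "infsum (\<lambda>\<alpha>. U \<alpha> - T \<alpha>) A \<le> 0"
      using U_le by (simp add: infsumI)
    then have "U \<alpha> - T \<alpha> = 0"
      by (rule nonneg_infsum_le_0D[OF _ has_sum_imp_summable[OF UT_sum]]) (use T_le_U that in auto)
    then show ?thesis by simp
  qed
  have Q0: "Q \<alpha> 0 = T \<alpha>" if \<alpha>: "\<alpha> \<in> A" for \<alpha>
  proof -
    obtain l where l: "l \<in> \<Lambda>" "\<alpha> = \<rho> l"
      using \<alpha> by (auto simp: A_def)
    have "y - \<alpha> \<notin> G"
    proof
      assume "y - \<alpha> \<in> G"
      then have "(y - \<alpha>) + (\<rho> l - l) \<in> G"
        using \<rho> by (intro G_add) (auto simp: coset_rep_def)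
      then show False using y[OF l(1)] l by simp
    qed
    \<comment> \<open>This is where \<open>y\<close> must avoid \<open>\<Lambda> + G\<close>. With
      positive weight on class 0, a value \<open>Q \<alpha> 0\<close> below the maximum would push
      \<open>T \<alpha>\<close> strictly below \<open>U \<alpha>\<close>.\<close>
    then have W0: "W \<alpha> 0 > 0"
      by (simp add: W_def fourier_D_eq_0_iff)
    have split: "(\<Sum>k<P. g k) = g 0 + (\<Sum>k\<in>{..<P} - {0}. g k)" for g :: "nat \<Rightarrow> real"
      using P by (intro sum.remove) auto
    have "U \<alpha> = W \<alpha> 0 * Q \<alpha> 0 + (\<Sum>k\<in>{..<P} - {0}. W \<alpha> k * Q \<alpha> k)"
      unfolding UT[OF \<alpha>] T_eq by (rule split)
    also have "(\<Sum>k\<in>{..<P} - {0}. W \<alpha> k * Q \<alpha> k) \<le> (\<Sum>k\<in>{..<P} - {0}. W \<alpha> k * U \<alpha>)"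
      unfolding U_def by (intro sum_mono mult_left_mono \<phi> W_nonneg) auto
    also have "\<dots> = ((\<Sum>k<P. W \<alpha> k) - W \<alpha> 0) * U \<alpha>"
      unfolding split[of "W \<alpha>"] by (simp add: sum_distrib_right)
    also have "\<dots> \<le> (1 - W \<alpha> 0) * U \<alpha>"
      using W_le[of \<alpha>] Q_nonneg by (intro mult_right_mono) (auto simp: U_def)
    finally have "W \<alpha> 0 * U \<alpha> \<le> W \<alpha> 0 * Q \<alpha> 0"
      by (simp add: algebra_simps)
    then have "U \<alpha> \<le> Q \<alpha> 0"
      using W0 by simp
    moreover have "Q \<alpha> 0 \<le> U \<alpha>"
      unfolding U_def using P by (rule \<phi>)
    ultimately show ?thesis using UT[OF \<alpha>] by simp
  qed
  \<comment> \<open>Class 0 everywhere is the given selection. Since \<rho> is arbitrary, treating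
    class 0 alone settles every selection.\<close>
  have S0: "S (\<lambda>_. 0) = selection \<rho> \<Lambda>"
    by (simp add: S_def)
  have "(T has_sum infsum q (selection \<rho> \<Lambda>)) A"
    using Q_sum[of "\<lambda>_. 0"] Q0 unfolding S0 by (subst has_sum_cong[of A T "\<lambda>\<alpha>. Q \<alpha> 0"]) auto
  then have "infsum q (selection \<rho> \<Lambda>) = 1"
    using T_sum by (rule has_sum_unique)
  then show ?thesis
    using has_sum_infsum[OF q_S[of "\<lambda>_. 0"]] unfolding S0 q_def by simp
qed

text \<open>Completeness climbs from characters off \<open>\<Lambda> + G\<close> to all characters,
  to bounded functions, and by truncation to L2(\<nu>).\<close>

lemma spectrum_selection:
  assumes \<nu>: "real_distribution \<nu>" and spec: "is_spectrum (D \<star> \<nu>) \<Lambda>" and \<rho>: "coset_rep \<rho>"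
  shows "is_spectrum \<nu> (selection \<rho> \<Lambda>)"
proof -
  interpret \<nu>: real_distribution \<nu> by fact
  interpret \<mu>: real_distribution "D \<star> \<nu>"
    by (intro real_distribution_convolution real_distribution_D \<nu>)
  have countable: "countable \<Lambda>" and discrete: "topological_space_class.discrete \<Lambda>"
    and orth: "orthogonal_characters (D \<star> \<nu>) \<Lambda>"
    and approx: "\<And>f. square_integrable (D \<star> \<nu>) f \<Longrightarrow> L2_approximable (D \<star> \<nu>) \<Lambda> character f"
    using spec by (auto simp: \<mu>.is_spectrum_iff)
  let ?\<Lambda> = "selection \<rho> \<Lambda>"
  have sub: "?\<Lambda> \<subseteq> \<Lambda>" by (auto simp: selection_def)
  have orth': "orthogonal_characters \<nu> ?\<Lambda>"
    by (rule orthogonal_selection[OF \<nu> orth \<rho>])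
  have char: "L2_approximable \<nu> ?\<Lambda> character (character l)" for l
  proof (rule \<nu>.approximable_of_dense)
    have "UNIV - {y. \<forall>l\<in>\<Lambda>. y - l \<notin> G} \<subseteq> (\<Union>l\<in>\<Lambda>. (\<lambda>g. l + g) ` G)"
      by (force intro: image_eqI[of _ _ "_ - _"])
    then show "countable (UNIV - {y. \<forall>l\<in>\<Lambda>. y - l \<notin> G})"
      by (rule countable_subset) (intro countable_UN countable countable_image countable_G)
    fix y assume "y \<in> {y. \<forall>l\<in>\<Lambda>. y - l \<notin> G}"
    then have "((\<lambda>l. (norm (fourier \<nu> (y - l)))\<^sup>2) has_sum 1) ?\<Lambda>"
      by (intro selection_parseval[OF \<nu> orth \<rho>] \<mu>.parseval_of_approximable[OF orth] approx) auto
    then show "L2_approximable \<nu> ?\<Lambda> character (character y)"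
      by (rule \<nu>.approximable_of_parseval[OF orth'])
  qed
  \<comment> \<open>A bounded \<open>g\<close> lies in L2 of the convolution, where characters from
    the whole of \<Lambda> approximate it; the passage to \<nu> costs a factor \<open>P\<close>.
    Those frequencies may lie outside the selection, but \<open>char\<close> approximates each of
    their characters by selected ones.\<close>
  have bounded: "L2_approximable \<nu> ?\<Lambda> character g"
    if g: "g \<in> borel_measurable borel" "\<And>x. norm (g x) \<le> B" for g B
  proof (rule L2_approximable_closed)
    show "square_integrable \<nu> g"
      using g by (intro square_integrable_bounded[of _ _ B]) (auto simp: \<nu>.finite_measure_axioms)
    have g\<mu>: "square_integrable (D \<star> \<nu>) g"
      using g by (intro square_integrable_bounded[of _ _ B]) (auto simp: \<mu>.finite_measure_axioms)
    fix \<epsilon> :: real assume "\<epsilon> > 0"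
    then have "\<epsilon> / P > 0" using P by simp
    then obtain F c where F: "finite F" "F \<subseteq> \<Lambda>"
      "(LINT x|(D \<star> \<nu>). (norm (g x - (\<Sum>i\<in>F. c i * character i x)))\<^sup>2) < \<epsilon> / P"
      using L2_approximableD[OF approx[OF g\<mu>]] by blast
    have "square_integrable (D \<star> \<nu>) (\<lambda>x. g x - (\<Sum>i\<in>F. c i * character i x))"
      by (intro square_integrable_diff g\<mu> \<mu>.character_sum_square_integrable)
    from square_integrable_dirac_average_convolution(2)[OF \<nu> _ _ this]
    have "(LINT x|\<nu>. (norm (g x - (\<Sum>i\<in>F. c i * character i x)))\<^sup>2)
        \<le> real P * (LINT x|(D \<star> \<nu>). (norm (g x - (\<Sum>i\<in>F. c i * character i x)))\<^sup>2)"
      by (simp add: zero_in_progression P card_progression t)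
    also have "\<dots> < \<epsilon>"
      using F(3) P by (simp add: field_simps)
    finally show "\<exists>h. square_integrable \<nu> h \<and> L2_approximable \<nu> ?\<Lambda> character h \<and>
        (LINT x|\<nu>. (norm (g x - h x))\<^sup>2) < \<epsilon>"
      by (intro exI[of _ "\<lambda>x. \<Sum>i\<in>F. c i * character i x"] conjI
          \<nu>.character_sum_square_integrable L2_approximable_sum L2_approximable_cmult char
          square_integrable_cmult) auto
  qed auto
  have "L2_approximable \<nu> ?\<Lambda> character f" if f: "square_integrable \<nu> f" for f
  proof (rule L2_approximable_closed)
    fix \<epsilon> :: real assume "\<epsilon> > 0"
    then obtain B where B: "(LINT x|\<nu>. (norm (f x - (if norm (f x) \<le> B then f x else 0)))\<^sup>2) < \<epsilon>"
      using square_integrable_truncate[OF f] by blast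
    let ?g = "\<lambda>x. if norm (f x) \<le> B then f x else 0"
    have [measurable]: "f \<in> borel_measurable borel"
      using f unfolding square_integrable_def measurable_cong_sets[OF \<nu>.events_eq_borel refl]
      by blast
    have g: "?g \<in> borel_measurable borel" "\<And>x. norm (?g x) \<le> max B 0" by auto
    have "square_integrable \<nu> ?g"
      using g by (intro square_integrable_bounded[of _ _ "max B 0"]) (auto simp: \<nu>.finite_measure_axioms)
    with bounded[OF g] B
    show "\<exists>g. square_integrable \<nu> g \<and> L2_approximable \<nu> ?\<Lambda> character g \<and>
        (LINT x|\<nu>. (norm (f x - g x))\<^sup>2) < \<epsilon>"
      by (intro exI[of _ ?g]) simp
  qed (use f in auto)
  then show ?thesis
    unfolding \<nu>.is_spectrum_iff
    using countable_subset[OF sub countable] discrete_subset[OF discrete sub] orth' by blast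
qed

text \<open>Two selections are compared that differ only in the coset of \<open>l0\<close>, one
  taking the class of \<open>l0\<close> and the other the class of \<open>l0 + d\<close>. If the
  latter class were missing, the second selection would be contained in the first without
  \<open>l0\<close>; but it is a spectrum, hence maximal.\<close>

lemma spectrum_meets_residues:
  assumes \<nu>: "real_distribution \<nu>" and spec: "is_spectrum (D \<star> \<nu>) \<Lambda>" and l0: "l0 \<in> \<Lambda>"
    and d: "d \<in> G"
  shows "\<exists>l\<in>\<Lambda>. l - l0 - d \<in> H"
proof (rule ccontr)
  assume *: "\<not> (\<exists>l\<in>\<Lambda>. l - l0 - d \<in> H)"
  interpret \<nu>: real_distribution \<nu> by fact
  interpret \<mu>: real_distribution "D \<star> \<nu>"
    by (intro real_distribution_convolution real_distribution_D \<nu>)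
  define r where "r c x = (if x - l0 \<in> G then c else frac (x * P * t) / (P * t))" for c x :: real
  have rep: "coset_rep (r l0)" "coset_rep (r (l0 + d))"
    unfolding r_def using d
    by (intro coset_rep_update coset_rep_frac; simp add: G_def)+
  have sub: "selection (r (l0 + d)) \<Lambda> \<subseteq> selection (r l0) \<Lambda>"
    using * by (auto simp: selection_def r_def diff_diff_eq)
  have "orthogonal_characters (D \<star> \<nu>) \<Lambda>"
    using spec by (simp add: \<mu>.is_spectrum_iff)
  then have "orthogonal_characters \<nu> (selection (r l0) \<Lambda>)"
    by (rule orthogonal_selection[OF \<nu> _ rep(1)])
  then have "selection (r l0) \<Lambda> = selection (r (l0 + d)) \<Lambda>"
    by (rule \<nu>.spectrum_maximal[OF spectrum_selection[OF \<nu> spec rep(2)] _ sub])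
  moreover have "l0 \<in> selection (r l0) \<Lambda>"
    using l0 by (auto simp: selection_def r_def H_def G_def)
  ultimately have "l0 - r (l0 + d) l0 \<in> H"
    by (auto simp: selection_def)
  then have "l0 - l0 - d \<in> H"
    by (simp add: r_def G_def)
  then show False using * l0 by blast
qed

end

section \<open>Rescaling\<close>

lemma (in real_distribution) fourier_scale:
  "fourier (distr M borel (\<lambda>x. c * x)) l = fourier M (c * l)"
  unfolding fourier_def by (subst integral_distr) (auto simp: character_scale)

lemma discrete_scale:
  fixes S :: "real set"
  assumes "topological_space_class.discrete S" "c \<noteq> 0"
  shows "topological_space_class.discrete ((\<lambda>x. x / c) ` S)"
  unfolding discrete_def
proof
  fix z assume "z \<in> (\<lambda>x. x / c) ` S"
  then obtain x where x: "x \<in> S" "z = x / c" by auto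
  then obtain e where e: "e > 0" "\<And>y. y \<in> S \<Longrightarrow> dist x y < e \<Longrightarrow> x = y"
    using assms(1) unfolding discrete_def isolated_in_dist_Ex_iff by blast
  have "x = y" if "y \<in> S" "dist (x / c) (y / c) < e / \<bar>c\<bar>" for y
  proof (rule e(2)[OF that(1)])
    have "dist (x / c) (y / c) = dist x y / \<bar>c\<bar>"
      by (simp add: dist_real_def flip: diff_divide_distrib)
    then show "dist x y < e"
      using that(2) assms(2) by (simp add: divide_less_cancel)
  qed
  moreover have "e / \<bar>c\<bar> > 0"
    using e(1) assms(2) by simp
  ultimately show "z isolated_in (\<lambda>x. x / c) ` S"
    unfolding isolated_in_dist_Ex_iff x(2) using x(1)
    by (intro conjI exI[of _ "e / \<bar>c\<bar>"]) auto
qed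

text \<open>Tails carry a factor \<open>1 / b\<close> in all their digits; dilation removes it, and
  frequencies move by the inverse factor.\<close>

lemma is_spectrum_scale:
  assumes M: "real_distribution M" and c: "c \<noteq> 0" and spec: "is_spectrum M \<Lambda>"
  shows "is_spectrum (distr M borel (\<lambda>x. c * x)) ((\<lambda>l. l / c) ` \<Lambda>)"
proof -
  interpret M: real_distribution M by fact
  let ?N = "distr M borel (\<lambda>x. c * x)"
  interpret N: real_distribution ?N by simp
  have *: "countable \<Lambda>" "topological_space_class.discrete \<Lambda>" "orthogonal_characters M \<Lambda>"
    "\<And>f. square_integrable M f \<Longrightarrow> L2_approximable M \<Lambda> character f"
    using spec by (auto simp: M.is_spectrum_iff)
  have "orthogonal_characters ?N ((\<lambda>l. l / c) ` \<Lambda>)"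
    using *(3) c by (auto simp: orthogonal_characters_def M.fourier_scale right_diff_distrib)
  moreover have "L2_approximable ?N ((\<lambda>l. l / c) ` \<Lambda>) character f" if f: "square_integrable ?N f" for f
    unfolding L2_approximable_def
  proof (intro allI impI)
    fix \<epsilon> :: real assume "\<epsilon> > 0"
    have [measurable]: "f \<in> borel_measurable borel" and int: "integrable ?N (\<lambda>x. (norm (f x))\<^sup>2)"
      using f by (auto simp: square_integrable_def)
    have "square_integrable M (\<lambda>x. f (c * x))"
      using int by (simp add: square_integrable_def integrable_distr_eq)
    then obtain F d where F: "finite F" "F \<subseteq> \<Lambda>"
      "(LINT x|M. (norm (f (c * x) - (\<Sum>i\<in>F. d i * character i x)))\<^sup>2) < \<epsilon>"
      using L2_approximableD[OF *(4)] \<open>\<epsilon> > 0\<close> by blast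
    have "(\<Sum>i\<in>(\<lambda>l. l / c) ` F. d (c * i) * character i (c * x)) = (\<Sum>i\<in>F. d i * character i x)" for x
      using c by (subst sum.reindex) (auto simp: inj_on_def character_scale)
    then have "(LINT x|?N. (norm (f x - (\<Sum>i\<in>(\<lambda>l. l / c) ` F. d (c * i) * character i x)))\<^sup>2) < \<epsilon>"
      using F(3) by (simp add: integral_distr)
    then show "\<exists>F' d'. finite F' \<and> F' \<subseteq> (\<lambda>l. l / c) ` \<Lambda> \<and>
        (LINT x|?N. (norm (f x - (\<Sum>i\<in>F'. d' i * character i x)))\<^sup>2) < \<epsilon>"
      using F(1,2) by (intro exI[of _ "(\<lambda>l. l / c) ` F"] exI[of _ "\<lambda>i. d (c * i)"]) auto
  qed
  ultimately show ?thesis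
    using * c by (simp add: N.is_spectrum_iff discrete_scale)
qed

lemma compactly_supported_scale:
  assumes M: "real_distribution M" and "compactly_supported M"
  shows "compactly_supported (distr M borel (\<lambda>x. c * x))"
proof -
  interpret M: real_distribution M by fact
  obtain K where K: "compact K" "emeasure M (- K) = 0"
    using assms(2) by (auto simp: compactly_supported_def)
  have c: "compact ((\<lambda>x. c * x) ` K)"
    by (intro compact_continuous_image K continuous_intros)
  then have [measurable]: "(\<lambda>x. c * x) ` K \<in> sets borel" "K \<in> sets borel"
    using K(1) by (auto intro: borel_compact)
  have "emeasure (distr M borel (\<lambda>x. c * x)) (- (\<lambda>x. c * x) ` K)
      = emeasure M ((\<lambda>x. c * x) -` (- (\<lambda>x. c * x) ` K) \<inter> space M)"
    by (rule emeasure_distr) auto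
  also have "\<dots> \<le> emeasure M (- K)"
    by (rule emeasure_mono) auto
  finally show ?thesis
    unfolding compactly_supported_def using c K(2) by (intro exI[of _ "(\<lambda>x. c * x) ` K"]) auto
qed

text \<open>Domination of \<nu> by a multiple of the convolution lets the same compact set
  serve.\<close>

lemma compactly_supported_of_dirac_average_convolution:
  assumes \<nu>: "real_distribution \<nu>" and E: "finite E" "0 \<in> E"
    and "compactly_supported (dirac_average E \<star> \<nu>)"
  shows "compactly_supported \<nu>"
proof -
  interpret \<nu>: real_distribution \<nu> by fact
  obtain K where K: "compact K" "emeasure (dirac_average E \<star> \<nu>) (- K) = 0"
    using assms(4) by (auto simp: compactly_supported_def)
  then have [measurable]: "K \<in> sets borel"
    by (intro borel_compact)
  have "emeasure \<nu> (- K) \<le> of_nat (card E) * emeasure (dirac_average E \<star> \<nu>) (- K)"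
    using nn_integral_le_dirac_average_convolution[OF \<nu> E, of "indicator (- K)"] by simp
  then show ?thesis
    unfolding compactly_supported_def using K by (intro exI[of _ K]) simp
qed

section \<open>Convergence of infinite convolutions\<close>

lemma AE_convolution:
  assumes M: "real_distribution M" "AE x in M. \<bar>x\<bar> \<le> r"
    and N: "real_distribution N" "AE x in N. \<bar>x\<bar> \<le> s"
  shows "AE x in M \<star> N. \<bar>x\<bar> \<le> r + s"
proof -
  interpret M: real_distribution M by fact
  interpret N: real_distribution N by fact
  interpret MN: pair_prob_space M N ..
  have "AE z in M \<Otimes>\<^sub>M N. \<bar>fst z + snd z\<bar> \<le> r + s"
  proof (rule MN.AE_pair_measure)
    show "AE x in M. AE y in N. \<bar>fst (x, y) + snd (x, y)\<bar> \<le> r + s"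
      using M(2)
    proof eventually_elim
      case (elim x)
      from N(2) show ?case
        by eventually_elim (use elim in auto)
    qed
  qed measurable
  then show ?thesis
    unfolding convolution_def by (subst AE_distr_iff) (auto simp: split_beta)
qed

lemma (in real_distribution) norm_fourier_minus_1_le:
  assumes "AE x in M. \<bar>x\<bar> \<le> r"
  shows "norm (fourier M l - 1) \<le> 2 * pi * \<bar>l\<bar> * r"
proof -
  have bound: "AE x in M. norm (character l x - 1) \<le> 2 * pi * \<bar>l\<bar> * r"
    using assms
  proof eventually_elim
    case (elim x)
    have "norm (character l x - 1) \<le> \<bar>2 * pi * l * x\<bar>"
      using iexp_approx1[of "2 * pi * l * x" 0] by (simp add: character_def mult_ac)
    also have "\<dots> = 2 * pi * \<bar>l\<bar> * \<bar>x\<bar>"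
      by (simp add: abs_mult)
    also have "\<dots> \<le> 2 * pi * \<bar>l\<bar> * r"
      using elim by (intro mult_left_mono) auto
    finally show ?case .
  qed
  have "fourier M l - 1 = (LINT x|M. character l x - 1)"
    using prob_space by (simp add: fourier_def)
  also have "norm \<dots> \<le> (LINT x|M. norm (character l x - 1))"
    by (rule integral_norm_bound)
  also have "\<dots> \<le> (LINT x|M. 2 * pi * \<bar>l\<bar> * r)"
    by (intro integral_mono_AE bound integrable_norm Bochner_Integration.integrable_diff) auto
  also have "\<dots> = 2 * pi * \<bar>l\<bar> * r"
    using prob_space by simp
  finally show ?thesis .
qed

text \<open>This makes the definite description in \<open>infinite_convolution\<close> meaningful.
  Uniformly bounded supports give tightness, hence a subsequential limit; convergence of the
  characteristic functions identifies it as the limit of the whole sequence.\<close>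

lemma infinite_convolution_converges:
  assumes M: "\<And>n. real_distribution (M n)"
    and r: "\<And>n. n \<ge> 1 \<Longrightarrow> AE x in M n. \<bar>x\<bar> \<le> r n" "\<And>n. r n \<ge> 0" "summable r"
  shows "real_distribution (infinite_convolution M)"
    and "(\<lambda>n. \<Prod>i<n. fourier (M (Suc i)) l) \<longlonglongrightarrow> fourier (infinite_convolution M) l"
proof -
  let ?X = "partial_convolution M"
  interpret M: real_distribution "M n" for n by (rule M)
  have X: "real_distribution (?X n)" for n
  proof (induction n)
    case 0
    show ?case
      by (simp add: real_distribution_def real_distribution_axioms_def prob_space_return)
  qed (simp add: real_distribution_convolution M)
  interpret X: real_distribution "?X n" for n by (rule X)
  have fourier_X: "fourier (?X n) l = (\<Prod>i<n. fourier (M (Suc i)) l)" for n l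
  proof (induction n)
    case 0
    show ?case by (simp add: fourier_def integral_return)
  next
    case (Suc n)
    then show ?case by (simp add: fourier_convolution[OF X M])
  qed
  have AE_X: "AE x in ?X n. \<bar>x\<bar> \<le> (\<Sum>i<n. r (Suc i))" for n
  proof (induction n)
    case 0
    show ?case
      unfolding partial_convolution.simps by (subst AE_return) auto
  next
    case (Suc n)
    show ?case
      unfolding partial_convolution.simps sum.lessThan_Suc
      by (intro AE_convolution X M Suc r) simp
  qed
  \<comment> \<open>The extra 1 makes the bound on the supports strict, as the half-open interval in
    the definition of tightness requires.\<close>
  define R where "R = suminf r + 1"
  have "summable (\<lambda>i. r (Suc i))"
    using r(3) by (simp add: summable_Suc_iff)
  have sum_le: "(\<Sum>i<n. r (Suc i)) < R" for n
  proof -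
    have "(\<Sum>i<n. r (Suc i)) \<le> (\<Sum>i<Suc n. r i)"
      unfolding sum.lessThan_Suc_shift using r(2) by simp
    also have "\<dots> \<le> suminf r"
      using r by (intro sum_le_suminf) auto
    finally show ?thesis by (simp add: R_def)
  qed
  have "tight ?X"
    unfolding tight_def
  proof (intro conjI allI impI X)
    fix \<epsilon> :: real assume "\<epsilon> > 0"
    have "measure (?X n) {-R<..R} = 1" for n
    proof -
      have "AE x in ?X n. x \<in> {-R<..R}"
        using AE_X[of n] by (rule eventually_mono) (use sum_le[of n] in auto)
      then show ?thesis
        by (subst X.prob_eq_1) auto
    qed
    moreover have "R > 0" using sum_le[of 0] by simp
    ultimately show "\<exists>a b. a < b \<and> (\<forall>n. measure (?X n) {a<..b} > 1 - \<epsilon>)"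
      using \<open>\<epsilon> > 0\<close> by (intro exI[of _ "-R"] exI[of _ R]) auto
  qed
  from tight_imp_convergent_subsubsequence[OF this, of id]
  obtain s \<nu> where s: "strict_mono (s :: nat \<Rightarrow> nat)" "real_distribution \<nu>" "weak_conv_m (?X \<circ> s) \<nu>"
    by (auto simp: strict_mono_id)
  \<comment> \<open>Successive characteristic functions differ by at most a multiple of
    \<open>r (Suc n)\<close>, so the telescoping series converges absolutely.\<close>
  have conv: "convergent (\<lambda>n. char (?X n) u)" for u
  proof -
    define l where "l = u / (2 * pi)"
    have "norm (char (?X (Suc n)) u - char (?X n) u) \<le> 2 * pi * \<bar>l\<bar> * r (Suc n)" for n
    proof -
      have "char (?X (Suc n)) u - char (?X n) u = fourier (?X n) l * (fourier (M (Suc n)) l - 1)"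
        by (simp add: char_eq_fourier l_def fourier_convolution[OF X M] algebra_simps)
      also have "norm \<dots> \<le> 1 * (2 * pi * \<bar>l\<bar> * r (Suc n))"
        unfolding norm_mult fourier_eq_char[of "?X n"]
        by (intro mult_mono X.cmod_char_le_1 M.norm_fourier_minus_1_le r(1)) auto
      finally show ?thesis by simp
    qed
    then have "summable (\<lambda>n. char (?X (Suc n)) u - char (?X n) u)"
      by (intro summable_comparison_test'[OF summable_mult[OF \<open>summable (\<lambda>i. r (Suc i))\<close>]]) auto
    from tendsto_add[OF summable_LIMSEQ[OF this] tendsto_const[of "char (?X 0) u"]]
    show ?thesis
      unfolding sum_lessThan_telescope[of "\<lambda>n. char (?X n) u"] diff_add_cancel by (rule convergentI)
  qed
  have lim: "(\<lambda>n. char (?X n) u) \<longlonglongrightarrow> char \<nu> u" for u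
  proof -
    from conv obtain L where L: "(\<lambda>n. char (?X n) u) \<longlonglongrightarrow> L"
      by (auto simp: convergent_def)
    have "(\<lambda>n. char ((?X \<circ> s) n) u) \<longlonglongrightarrow> L"
      using LIMSEQ_subseq_LIMSEQ[OF L s(1)] by (simp add: o_def)
    moreover have "(\<lambda>n. char ((?X \<circ> s) n) u) \<longlonglongrightarrow> char \<nu> u"
      by (rule levy_continuity1[OF _ s(2,3)]) (simp add: X)
    ultimately have "L = char \<nu> u" by (rule LIMSEQ_unique)
    then show ?thesis using L by simp
  qed
  have "infinite_convolution M = \<nu>"
    by (rule infinite_convolution_eqI[OF M s(2) levy_continuity[OF X s(2) lim]])
  then show "real_distribution (infinite_convolution M)"
      "(\<lambda>n. \<Prod>i<n. fourier (M (Suc i)) l) \<longlonglongrightarrow> fourier (infinite_convolution M) l"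
    using s(2) lim[of "2 * pi * l"] by (simp_all add: fourier_X flip: fourier_eq_char)
qed

section \<open>Moran measures\<close>

lemma AE_dirac_average:
  assumes "finite E" "E \<noteq> {}" "\<And>e. e \<in> E \<Longrightarrow> \<bar>e\<bar> \<le> r"
  shows "AE x in dirac_average E. \<bar>x\<bar> \<le> r"
  unfolding dirac_average_def using assms by (subst AE_distr_iff) (auto simp: AE_measure_pmf_iff)

lemma fourier_dirac_average_scale:
  assumes "finite E" "E \<noteq> {}" "c \<noteq> 0"
  shows "fourier (dirac_average ((\<lambda>x. x / c) ` E)) l = fourier (dirac_average E) (l / c)"
proof -
  have inj: "inj_on (\<lambda>x. x / c) E"
    using assms(3) by (auto simp: inj_on_def)
  have "character l (x / c) = character (l / c) x" for x
    by (simp add: character_eq_cis)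
  then show ?thesis
    using assms inj by (simp add: fourier_dirac_average sum.reindex card_image)
qed

lemma digit_set_eq_progression:
  "(\<lambda>d. of_int d / c) ` digit_set p t k = (\<lambda>x. x / c) ` progression (nat (p k)) (of_int (t k))"
proof -
  have "{0..p k - 1} = int ` {..<nat (p k)}"
    by (auto simp: image_iff intro!: bexI[of _ "nat _"])
  then show ?thesis
    by (simp add: digit_set_def progression_def image_image)
qed

locale moran =
  fixes b p t :: "nat \<Rightarrow> int" and C :: real
  assumes p_ge: "k \<ge> 1 \<Longrightarrow> p k \<ge> 2"
    and b_ge: "k \<ge> 1 \<Longrightarrow> \<bar>b k\<bar> \<ge> 2"
    and t_ge: "k \<ge> 1 \<Longrightarrow> \<bar>t k\<bar> \<ge> 1"
    and pt_le: "k \<ge> 1 \<Longrightarrow> of_int \<bar>p k * t k\<bar> \<le> C"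
begin

abbreviation digits :: "nat \<Rightarrow> real measure" where
  "digits k \<equiv> dirac_average (progression (nat (p k)) (of_int (t k)))"

text \<open>The factors of all tails in one family; \<open>k = 0\<close> gives those of the full
  measure, so that it can be treated as a tail.\<close>

definition factor :: "nat \<Rightarrow> nat \<Rightarrow> real measure" where
  "factor k n = dirac_average
     ((\<lambda>d. of_int d / (\<Prod>j=k+1..k+n. of_int (b j))) ` digit_set p t (k + n))"

lemma moran_tail_eq: "moran_tail b p t k = infinite_convolution (factor k)"
  by (simp add: moran_tail_def factor_def[abs_def])

lemma moran_measure_eq_tail: "moran_measure b p t = moran_tail b p t 0"
  by (simp add: moran_measure_def moran_tail_def)

lemma mask: "k \<ge> 1 \<Longrightarrow> progression_mask (nat (p k)) (of_int (t k))"
  using p_ge[of k] t_ge[of k] by unfold_locales auto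

lemma progression_ne: "k \<ge> 1 \<Longrightarrow> progression (nat (p k)) (of_int (t k)) \<noteq> {}"
  using zero_in_progression[of "nat (p k)"] p_ge[of k] by auto

lemma b_nonzero: "k \<ge> 1 \<Longrightarrow> real_of_int (b k) \<noteq> 0"
  using b_ge[of k] by auto

lemma prod_b_ge: "2 ^ n \<le> \<bar>\<Prod>j=k+1..k+n. real_of_int (b j)\<bar>"
proof (induction n)
  case (Suc n)
  have "2 \<le> \<bar>real_of_int (b (k + Suc n))\<bar>"
    using b_ge[of "k + Suc n"] by linarith
  from mult_mono[OF Suc this] show ?case
    by (simp add: prod.nat_ivl_Suc' abs_mult mult.commute)
qed simp

lemma prod_b_nonzero: "(\<Prod>j=k+1..k+n. real_of_int (b j)) \<noteq> 0"
  using b_nonzero by (auto simp: prod_zero_iff)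

lemma fourier_factor:
  assumes "n \<ge> 1"
  shows "fourier (factor k n) l = fourier (digits (k + n)) (l / (\<Prod>j=k+1..k+n. real_of_int (b j)))"
  unfolding factor_def digit_set_eq_progression using assms
  by (intro fourier_dirac_average_scale progression_ne prod_b_nonzero) auto

lemma C_nonneg: "C \<ge> 0"
  using pt_le[of 1] by linarith

text \<open>Digits are bounded by \<open>\<bar>p * t\<bar>\<close>, hence by \<open>C\<close>, while
  the product of \<open>n\<close> factors \<open>b\<close> is at least \<open>2 ^ n\<close> in
  modulus. The radii are therefore summable, as the convergence lemma asks.\<close>

lemma AE_factor:
  assumes "n \<ge> 1"
  shows "AE x in factor k n. \<bar>x\<bar> \<le> C * (1 / 2) ^ n"
  unfolding factor_def digit_set_eq_progression
proof (rule AE_dirac_average)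
  fix e assume "e \<in> (\<lambda>x. x / (\<Prod>j=k+1..k+n. real_of_int (b j))) `
    progression (nat (p (k + n))) (real_of_int (t (k + n)))"
  then obtain i where i: "i < nat (p (k + n))"
      "e = real i * of_int (t (k + n)) / (\<Prod>j=k+1..k+n. real_of_int (b j))"
    by (auto simp: progression_def)
  have "real i * \<bar>of_int (t (k + n))\<bar> \<le> of_int (p (k + n)) * \<bar>of_int (t (k + n))\<bar>"
    using i by (intro mult_right_mono) auto
  also have "\<dots> = of_int \<bar>p (k + n) * t (k + n)\<bar>"
    using p_ge[of "k + n"] assms by (simp add: abs_mult)
  also have "\<dots> \<le> C"
    using assms by (intro pt_le) auto
  finally have "real i * \<bar>of_int (t (k + n))\<bar> \<le> C" .
  moreover have "0 \<le> real i * \<bar>of_int (t (k + n))\<bar>" by simp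
  ultimately have "real i * \<bar>of_int (t (k + n))\<bar> / \<bar>\<Prod>j=k+1..k+n. real_of_int (b j)\<bar> \<le> C / 2 ^ n"
    using prod_b_ge[of n k] C_nonneg by (intro frac_le) auto
  then show "\<bar>e\<bar> \<le> C * (1 / 2) ^ n"
    by (simp only: i abs_mult abs_divide abs_of_nat power_one_over) simp
qed (use assms progression_ne in auto)

lemma
  shows real_distribution_tail: "real_distribution (moran_tail b p t k)"
    and fourier_tail_LIMSEQ:
      "(\<lambda>n. \<Prod>i<n. fourier (factor k (Suc i)) l) \<longlonglongrightarrow> fourier (moran_tail b p t k) l"
proof -
  have "summable (\<lambda>n. C * (1 / 2) ^ n)"
    by (intro summable_mult summable_geometric) simp
  moreover have "real_distribution (factor k n)" for n
    unfolding factor_def by (rule real_distribution_dirac_average)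
  ultimately show "real_distribution (moran_tail b p t k)"
      "(\<lambda>n. \<Prod>i<n. fourier (factor k (Suc i)) l) \<longlonglongrightarrow> fourier (moran_tail b p t k) l"
    using AE_factor C_nonneg unfolding moran_tail_eq
    by (auto intro!: infinite_convolution_converges[where r="\<lambda>n. C * (1 / 2) ^ n"])
qed

section \<open>Self-similarity: one step of the tail\<close>

lemma fourier_factor_Suc:
  assumes "n \<ge> 1"
  shows "fourier (factor k (Suc n)) l = fourier (factor (Suc k) n) (l / of_int (b (Suc k)))"
proof -
  have "(\<Prod>j=k+1..k+Suc n. real_of_int (b j)) = of_int (b (k+1)) * (\<Prod>j=Suc (k+1)..k+Suc n. of_int (b j))"
    by (rule prod.atLeast_Suc_atMost) simp
  then have "(\<Prod>j=k+1..k+Suc n. real_of_int (b j)) = of_int (b (Suc k)) * (\<Prod>j=Suc k+1..Suc k+n. of_int (b j))"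
    by (simp only: add_Suc_right add_Suc Suc_eq_plus1[symmetric])
  moreover have "k + Suc n = Suc k + n" by simp
  ultimately show ?thesis
    using assms by (simp only: fourier_factor le_SucI divide_divide_eq_left)
qed

lemma fourier_tail_Suc:
  "fourier (moran_tail b p t k) l =
     fourier (digits (Suc k)) (l / of_int (b (Suc k)))
       * fourier (moran_tail b p t (Suc k)) (l / of_int (b (Suc k)))"
proof (rule LIMSEQ_unique)
  let ?l = "l / of_int (b (Suc k))"
  show "(\<lambda>n. \<Prod>i<Suc n. fourier (factor k (Suc i)) l) \<longlonglongrightarrow> fourier (moran_tail b p t k) l"
    using fourier_tail_LIMSEQ by (rule LIMSEQ_Suc)
  have "(\<Prod>i<Suc n. fourier (factor k (Suc i)) l)
      = fourier (digits (Suc k)) ?l * (\<Prod>i<n. fourier (factor (Suc k) (Suc i)) ?l)" for n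
    unfolding prod.lessThan_Suc_shift by (simp add: fourier_factor_Suc) (simp add: fourier_factor)
  then show "(\<lambda>n. \<Prod>i<Suc n. fourier (factor k (Suc i)) l)
      \<longlonglongrightarrow> fourier (digits (Suc k)) ?l * fourier (moran_tail b p t (Suc k)) ?l"
    by (simp only:) (intro tendsto_mult tendsto_const fourier_tail_LIMSEQ)
qed

text \<open>Multiplying by \<open>b (Suc k)\<close> clears the denominator shared by all factors and
  brings the tail into the form \<open>D \<star> \<nu>\<close>, to which the selection results
  apply.\<close>

lemma tail_scale:
  "distr (moran_tail b p t k) borel (\<lambda>x. of_int (b (Suc k)) * x)
     = (digits (Suc k) \<star> moran_tail b p t (Suc k))"
proof (rule Levy_uniqueness)
  interpret N: real_distribution "moran_tail b p t k" by (rule real_distribution_tail)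
  show "real_distribution (distr (moran_tail b p t k) borel (\<lambda>x. of_int (b (Suc k)) * x))"
    by simp
  show "real_distribution (digits (Suc k) \<star> moran_tail b p t (Suc k))"
    by (intro real_distribution_convolution real_distribution_dirac_average real_distribution_tail)
  show "char (distr (moran_tail b p t k) borel (\<lambda>x. of_int (b (Suc k)) * x))
      = char (digits (Suc k) \<star> moran_tail b p t (Suc k))"
    using b_nonzero[of "Suc k"]
    by (simp add: fun_eq_iff char_eq_fourier N.fourier_scale fourier_tail_Suc[of k]
        fourier_convolution real_distribution_dirac_average real_distribution_tail)
qed

lemma spectrum_tail_scale:
  assumes "is_spectrum (moran_tail b p t k) \<Lambda>"
  shows "is_spectrum (digits (Suc k) \<star> moran_tail b p t (Suc k)) ((\<lambda>l. l / of_int (b (Suc k))) ` \<Lambda>)"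
  unfolding tail_scale[symmetric]
  by (intro is_spectrum_scale real_distribution_tail b_nonzero assms) simp

text \<open>Every selection from the rescaled spectrum is a spectrum of the next tail, so the
  explicit representative given by fractional parts suffices.\<close>

lemma spectral_tail_Suc:
  assumes "spectral_measure (moran_tail b p t k)"
  shows "spectral_measure (moran_tail b p t (Suc k))"
proof -
  interpret progression_mask "nat (p (Suc k))" "of_int (t (Suc k))" by (rule mask) simp
  obtain \<Lambda> where \<Lambda>: "is_spectrum (moran_tail b p t k) \<Lambda>"
    and comp: "compactly_supported (moran_tail b p t k)"
    using assms by (auto simp: spectral_measure_def)
  have "compactly_supported (digits (Suc k) \<star> moran_tail b p t (Suc k))"
    unfolding tail_scale[symmetric] by (rule compactly_supported_scale[OF real_distribution_tail comp])
  then have "compactly_supported (moran_tail b p t (Suc k))"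
    by (rule compactly_supported_of_dirac_average_convolution[OF real_distribution_tail
          finite_progression zero_in_progression[OF P]])
  with spectrum_selection[OF real_distribution_tail spectrum_tail_scale[OF \<Lambda>] coset_rep_frac]
  show ?thesis
    by (auto simp: spectral_measure_def real_distribution_tail)
qed

text \<open>Choose the residues so that no point of the spectrum of \<open>moran_tail b p t k\<close> outside the coset
  of \<open>l0\<close> lies in the residue class \<open>R\<close> of \<open>l0 + b\<^sub>k\<^sub>+\<^sub>1 / (p\<^sub>k\<^sub>+\<^sub>1 t\<^sub>k\<^sub>+\<^sub>1)\<close>; this is possible because
  \<open>p\<^sub>k\<close> does not divide \<open>t\<^sub>k\<^sub>+\<^sub>1\<close>. The spectrum has to meet \<open>R\<close>, hence it does so in the coset of \<open>l0\<close>.\<close>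

lemma dvd_of_spectral:
  assumes k: "k \<ge> 1" and not_dvd: "\<not> p k dvd t (Suc k)"
    and spectral: "is_spectrum (digits k \<star> moran_tail b p t k) \<Lambda>"
  shows "p (Suc k) dvd b (Suc k) * t k"
proof -
  interpret A: progression_mask "nat (p k)" "of_int (t k)" by (rule mask) fact
  interpret B: progression_mask "nat (p (Suc k))" "of_int (t (Suc k))" by (rule mask) simp
  let ?c = "real_of_int (b (Suc k))"
  have c: "?c \<noteq> 0" by (rule b_nonzero) simp
  \<comment> \<open>The generator of \<open>B.G\<close>. As \<open>d * t (Suc k)\<close> equals
    \<open>1 / p (Suc k)\<close>, this class is responsible for the summand 1 in the final integer
    identity.\<close>
  define d where "d = 1 / (real (nat (p (Suc k))) * of_int (t (Suc k)))"
  have d: "d \<in> B.G"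
    using B.step_in_G[of 1] by (simp add: d_def)
  define s where "s = 1 / (real (nat (p k)) * of_int (t k))"
  have s: "s \<in> A.G"
    using A.step_in_G[of 1] by (simp add: s_def)

  interpret \<mu>: real_distribution "digits k \<star> moran_tail b p t k"
    by (intro real_distribution_convolution real_distribution_dirac_average real_distribution_tail)
  obtain l0 where l0: "l0 \<in> \<Lambda>"
    using \<mu>.spectrum_nonempty[OF spectral] by blast
  \<comment> \<open>The residue class of step \<open>Suc k\<close>, pulled back through the division
    by \<open>?c\<close> that rescales the spectrum.\<close>
  define R where "R = {y. (y - l0) / ?c - d \<in> B.H}"
  have R_diff: "(y - z) / ?c \<in> B.H" if "y \<in> R" "z \<in> R" for y z
  proof -
    have "((y - l0) / ?c - d) + - ((z - l0) / ?c - d) \<in> B.H"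
      using that by (intro B.H_add B.H_minus) (auto simp: R_def)
    then show ?thesis by (simp add: diff_divide_distrib)
  qed

  define r where "r x = frac (x * nat (p k) * of_int (t k)) / (nat (p k) * of_int (t k))" for x :: real
  \<comment> \<open>If \<open>R\<close> meets the class of \<open>x\<close> modulo
    \<open>A.H\<close>, the neighbouring class of \<open>x + s\<close> is taken instead, which
    \<open>R\<close> then cannot meet as well.\<close>
  define e where "e x = (if \<exists>y\<in>R. y - x \<in> A.H then s else 0)" for x
  define \<rho> where "\<rho> x = (if x - l0 \<in> A.G then l0 else r x + e (r x))" for x
  have \<rho>: "A.coset_rep \<rho>"
    unfolding \<rho>_def
  proof (rule A.coset_rep_update)
    show "A.coset_rep (\<lambda>x. r x + e (r x))"
      using s A.coset_rep_frac
      by (intro A.coset_rep_add) (auto simp: r_def[abs_def] e_def A.G_def)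
  qed (simp add: A.G_def)
  define \<Lambda>' where "\<Lambda>' = A.selection \<rho> \<Lambda>"
  have "is_spectrum (moran_tail b p t k) \<Lambda>'"
    unfolding \<Lambda>'_def by (intro A.spectrum_selection real_distribution_tail spectral \<rho>)
  note spec' = spectrum_tail_scale[OF this]
  have "l0 \<in> \<Lambda>'"
    using l0 by (simp add: \<Lambda>'_def A.selection_def \<rho>_def A.G_def A.H_def)
  then have "l0 / ?c \<in> (\<lambda>l. l / ?c) ` \<Lambda>'" by (rule imageI)
  from B.spectrum_meets_residues[OF real_distribution_tail spec' this d]
  obtain y where y: "y \<in> \<Lambda>'" "y / ?c - l0 / ?c - d \<in> B.H" by blast
  then have yR: "y \<in> R"
    by (simp add: R_def diff_divide_distrib)
  have y\<rho>: "y - \<rho> y \<in> A.H"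
    using y(1) by (simp add: \<Lambda>'_def A.selection_def)

  have "y - l0 \<in> A.G"
  proof (rule ccontr)
    assume "y - l0 \<notin> A.G"
    then have yH: "y - r y - e (r y) \<in> A.H"
      using y\<rho> by (simp add: \<rho>_def diff_diff_eq)
    show False
    proof (cases "\<exists>z\<in>R. z - r y \<in> A.H")
      case True
      then obtain z where z: "z \<in> R" "z - r y \<in> A.H" by blast
      have "(y - r y - s) + - (z - r y) \<in> A.H"
        using yH z True by (intro A.H_add A.H_minus) (auto simp: e_def)
      also have "(y - r y - s) + - (z - r y) = y - z - s"
        by simp
      finally obtain m where m: "(y - z - s) * of_int (t k) = of_int m"
        by (auto simp: A.H_def elim!: Ints_cases)
      obtain n where n: "(y - z) / ?c * of_int (t (Suc k)) = of_int n"
        using R_diff[OF yR z(1)] by (auto simp: B.H_def elim!: Ints_cases)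
      have "s * of_int (t k) * of_int (p k) = 1"
        using A.P A.t by (simp add: s_def)
      moreover have "(y - z) * of_int (t k) = of_int m + s * of_int (t k)"
        using m by (simp add: algebra_simps)
      ultimately have 1: "(y - z) * of_int (t k) * of_int (p k) = of_int (m * p k + 1)"
        by (simp add: distrib_right)
      have 2: "(y - z) * of_int (t (Suc k)) = of_int (n * b (Suc k))"
        using n c by (simp add: field_simps)
      have "(y - z) * of_int (t k) * of_int (p k) * of_int (t (Suc k))
          = (y - z) * of_int (t (Suc k)) * of_int (t k) * of_int (p k)"
        by (simp only: mult_ac)
      \<comment> \<open>Modulo \<open>p k\<close> only \<open>t (Suc k)\<close> survives, contrary
        to \<open>not_dvd\<close>: \<open>R\<close> cannot meet two neighbouring classes.\<close>
      then have eq: "(m * p k + 1) * t (Suc k) = n * b (Suc k) * t k * p k"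
        unfolding 1 2 of_int_mult[symmetric] of_int_eq_iff .
      have "t (Suc k) = p k * (n * b (Suc k) * t k - m * t (Suc k))"
        using eq by (simp add: algebra_simps)
      then show False
        using not_dvd by (metis dvd_triv_left)
    next
      case False
      then show False
        using yH yR by (auto simp: e_def)
    qed
  qed
  then have "y - l0 \<in> A.H"
    using y\<rho> by (simp add: \<rho>_def)
  then obtain m where m: "(y - l0) * of_int (t k) = of_int m"
    by (auto simp: A.H_def elim!: Ints_cases)
  obtain n where n: "((y - l0) / ?c - d) * of_int (t (Suc k)) = of_int n"
    using yR by (auto simp: R_def B.H_def elim!: Ints_cases)
  have "d * of_int (t (Suc k)) * of_int (p (Suc k)) = 1"
    using B.P B.t by (simp add: d_def)
  moreover have "(y - l0) / ?c * of_int (t (Suc k)) = of_int n + d * of_int (t (Suc k))"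
    using n by (simp add: algebra_simps)
  ultimately have "(y - l0) / ?c * of_int (t (Suc k)) * of_int (p (Suc k)) = of_int (n * p (Suc k) + 1)"
    by (simp add: distrib_right)
  then have *: "(y - l0) * of_int (t (Suc k)) * of_int (p (Suc k)) = of_int (b (Suc k) * (n * p (Suc k) + 1))"
    using c by (simp add: field_simps)
  have "(y - l0) * of_int (t k) * of_int (t (Suc k)) * of_int (p (Suc k))
      = (y - l0) * of_int (t (Suc k)) * of_int (p (Suc k)) * of_int (t k)"
    by (simp only: mult_ac)
  \<comment> \<open>Here \<open>y\<close> is congruent to \<open>l0\<close> modulo
    \<open>A.H\<close> and lies in \<open>R\<close>; modulo \<open>p (Suc k)\<close> only
    \<open>b (Suc k) * t k\<close> survives.\<close>
  then have eq: "m * t (Suc k) * p (Suc k) = b (Suc k) * (n * p (Suc k) + 1) * t k"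
    unfolding * m of_int_mult[symmetric] of_int_eq_iff .
  have "b (Suc k) * t k = p (Suc k) * (m * t (Suc k) - b (Suc k) * n * t k)"
    using eq by (simp add: algebra_simps)
  then show ?thesis
    by (metis dvd_triv_left)
qed

end

theorem theorem1p4:
  fixes b p t :: "nat \<Rightarrow> int"
  assumes p_ge: "\<And>k. k \<ge> 1 \<Longrightarrow> p k \<ge> 2"
    and b_ge: "\<And>k. k \<ge> 1 \<Longrightarrow> \<bar>b k\<bar> \<ge> 2"
    and t_ge: "\<And>k. k \<ge> 1 \<Longrightarrow> \<bar>t k\<bar> \<ge> 1"
    and pt_bounded: "\<exists>C. \<forall>k\<ge>1. \<bar>p k * t k\<bar> \<le> C"
    and not_dvd: "\<And>k. k \<ge> 1 \<Longrightarrow> \<not> p k dvd t (k + 1)"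
    and spectral: "spectral_measure (moran_measure b p t)"
  shows "\<forall>k\<ge>1. p (k + 1) dvd b (k + 1) * t k \<and> spectral_measure (moran_tail b p t k)"
proof -
  obtain C where C: "\<And>k. k \<ge> 1 \<Longrightarrow> \<bar>p k * t k\<bar> \<le> C"
    using pt_bounded by blast
  interpret moran b p t "of_int C"
    using p_ge b_ge t_ge C by unfold_locales (auto simp del: of_int_abs)
  \<comment> \<open>The induction starts at 0, where the tail is the full measure.\<close>
  have tail: "spectral_measure (moran_tail b p t k)" for k
  proof (induction k)
    case 0
    show ?case using spectral by (simp add: moran_measure_eq_tail)
  qed (rule spectral_tail_Suc)
  show ?thesis
  proof (intro allI impI conjI tail)
    fix k :: nat assume k: "1 \<le> k"
    \<comment> \<open>The divisibility needs a spectrum of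
      \<open>digits k \<star> moran_tail b p t k\<close>, which is a rescaled spectrum of the
      preceding tail; for \<open>k = 1\<close> that is the full measure.\<close>
    then obtain j where j: "k = Suc j"
      by (cases k) auto
    obtain \<Lambda> where "is_spectrum (moran_tail b p t j) \<Lambda>"
      using tail[of j] by (auto simp: spectral_measure_def)
    from dvd_of_spectral[OF k _ spectrum_tail_scale[OF this, folded j]] not_dvd[OF k]
    show "p (k + 1) dvd b (k + 1) * t k" by simp
  qed
qed

end
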